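(* Let $G$ be a finite group. If $\Pr(G)\in\left\{\frac{5}{14},\frac{2}{5},\frac{11}{27},\frac{1}{2},\frac{5}{8}\right\}$, then $G$ is super integral.
   Context: The commutativity degree of a finite group $G$ is $\Pr(G)=\frac{|\{(x,y)\in G\times G: xy=yx\}|}{|G|^2}$. The commuting graph $\Gamma_G$ of a finite non-abelian group $G$ with center $Z(G)$ is the simple undirected graph with vertex set $G\setminus Z(G)$ in which two distinct vertices $x,y$ are adjacent if and only if $xy=yx$. Let $A$ be the adjacency matrix and $D$ the (diagonal) degree matrix of $\Gamma_G$. A finite non-abelian group $G$ is called super integral if all eigenvalues of $A$, all eigenvalues of the Laplacian matrix $D-A$, and all eigenvalues of the signless Laplacian matrix $D+A$ are integers. *)

theory Defs
  imports
    Complex_Main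
    "HOL-Algebra.Coset"
    "Graph_Theory.Pair_Digraph"
    "Jordan_Normal_Form.Char_Poly"
begin

definition commuting_prob :: "('a, 'b) monoid_scheme \<Rightarrow> real" where
  "commuting_prob G =
     real (card {(x, y) \<in> carrier G \<times> carrier G. x \<otimes>\<^bsub>G\<^esub> y = y \<otimes>\<^bsub>G\<^esub> x})
       / (real (Coset.order G))\<^sup>2"

definition group_center :: "('a, 'b) monoid_scheme \<Rightarrow> 'a set" where
  "group_center G = {z \<in> carrier G. \<forall>x \<in> carrier G. z \<otimes>\<^bsub>G\<^esub> x = x \<otimes>\<^bsub>G\<^esub> z}"

text \<open>A simple undirected graph is encoded as a symmetric loop-free digraph without parallel arcs
  (locale \<^locale>\<open>pair_graph\<close>): each edge is represented by its two orientations.\<close>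

definition commuting_graph :: "('a, 'b) monoid_scheme \<Rightarrow> 'a pair_pre_digraph" where
  "commuting_graph G =
     \<lparr> pverts = carrier G - group_center G,
       parcs = {(x, y). x \<in> carrier G - group_center G \<and> y \<in> carrier G - group_center G
                  \<and> x \<noteq> y \<and> x \<otimes>\<^bsub>G\<^esub> y = y \<otimes>\<^bsub>G\<^esub> x} \<rparr>"

lemma pair_graph_commuting_graph:
  assumes "finite (carrier G)"
  shows "pair_graph (commuting_graph G)"
proof
  have "parcs (commuting_graph G) \<subseteq> carrier G \<times> carrier G"
    by (auto simp: commuting_graph_def)
  then show "finite (parcs (commuting_graph G))"
    using assms by (meson finite_SigmaI finite_subset)
qed (use assms in \<open>auto simp: commuting_graph_def symmetric_def arcs_ends_conv sym_def\<close>)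

text \<open>The rows and columns of the matrices of a graph \<open>H\<close> are indexed by positions in a list \<open>vs\<close>
  enumerating the vertices. The entries are taken in \<open>complex\<close>, so that \<^const>\<open>eigenvalue\<close>
  ranges over all complex eigenvalues. The degree of a vertex in an undirected graph is the
  out-degree in the encoding above, as every edge at a vertex has exactly one orientation
  leaving it.\<close>

definition adjacency_matrix :: "'a pair_pre_digraph \<Rightarrow> 'a list \<Rightarrow> complex mat" where
  "adjacency_matrix H vs =
     mat (length vs) (length vs) (\<lambda>(i, j). if (vs ! i, vs ! j) \<in> parcs H then 1 else 0)"

definition degree_matrix :: "'a pair_pre_digraph \<Rightarrow> 'a list \<Rightarrow> complex mat" where
  "degree_matrix H vs =
     mat (length vs) (length vs)
       (\<lambda>(i, j). if i = j then of_nat (out_degree (with_proj H) (vs ! i)) else 0)"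

definition laplacian_matrix :: "'a pair_pre_digraph \<Rightarrow> 'a list \<Rightarrow> complex mat" where
  "laplacian_matrix H vs = degree_matrix H vs - adjacency_matrix H vs"

definition signless_laplacian_matrix :: "'a pair_pre_digraph \<Rightarrow> 'a list \<Rightarrow> complex mat" where
  "signless_laplacian_matrix H vs = degree_matrix H vs + adjacency_matrix H vs"

definition integer_eigenvalues :: "complex mat \<Rightarrow> bool" where
  "integer_eigenvalues A \<longleftrightarrow> (\<forall>k. eigenvalue A k \<longrightarrow> k \<in> \<int>)"

text \<open>Different enumerations of the vertices give matrices that are conjugate by a permutation
  matrix, so the eigenvalues do not depend on \<open>vs\<close>; a suitable \<open>vs\<close> exists because the vertex set
  is finite.\<close>

definition super_integral :: "('a, 'b) monoid_scheme \<Rightarrow> bool" where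
  "super_integral G \<longleftrightarrow>
     group G \<and> finite (carrier G) \<and> \<not> comm_group G \<and>
     (\<forall>vs. distinct vs \<and> set vs = pverts (commuting_graph G) \<longrightarrow>
        integer_eigenvalues (adjacency_matrix (commuting_graph G) vs) \<and>
        integer_eigenvalues (laplacian_matrix (commuting_graph G) vs) \<and>
        integer_eigenvalues (signless_laplacian_matrix (commuting_graph G) vs))"

end

theory Submission
  imports Defs
begin

text \<open>
  If every noncentral element of \<open>G\<close> has an abelian centralizer, then \<open>\<Gamma>\<^sub>G\<close> is a disjoint union of
  cliques, and an eigenvector either has all its sums over cliques equal to zero or yields an
  integer eigenvalue through one nonzero clique sum. So let \<open>w\<close> be noncentral with \<open>C(w)\<close> nonabelian,
  let \<open>n = [G : Z(G)]\<close> and \<open>p = Pr(G)\<close>. Since \<open>p n\<^sup>2\<close> is an integer, the numerators and denominators of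
  the given values force \<open>14\<close>, \<open>5\<close> or \<open>9\<close> to divide \<open>n\<close> when \<open>p\<close> is \<open>5/14\<close>, \<open>2/5\<close> or \<open>11/27\<close>.
  Moreover \<open>n \<ge> 16\<close>, so \<open>p \<le> 1/2 + 1/(2n)\<close> excludes \<open>5/8\<close>.

  Without a conjugacy class of size two, \<open>p \<le> 1/3 + 2/(3n)\<close> and \<open>n \<ge> 24\<close>, which leaves only
  \<open>p = 5/14\<close> and \<open>n = 28\<close>. Otherwise let \<open>A = C(x)\<close> have index two and put \<open>r = [Z(A) : Z(G)]\<close>. Then
  \<open>p \<le> Pr(A)/4 + 3/(4r)\<close> with \<open>Pr(A) \<le> 5/8\<close>, which excludes \<open>r \<ge> 4\<close>, and for \<open>r = 3\<close> forces
  \<open>p \<le> 13/32\<close> and \<open>Pr(A) \<ge> 3/7\<close>. For \<open>r = 2\<close> the commutators of \<open>x\<close> form a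
  central subgroup \<open>N\<close> of order two, and counting commuting pairs modulo \<open>N\<close> gives \<open>p \<le> Pr(G/N)/2 + 1/8\<close>. The same two reductions show that a
  commuting probability of at least \<open>3/7\<close> forces the index of the center to divide \<open>3 \<cdot> 2\<^sup>k\<close>; this
  contradicts the divisibility of \<open>n\<close> in all remaining cases except \<open>p = 1/2\<close>, which is excluded by
  \<open>Pr(G/N)/2 < p\<close> if \<open>G/N\<close> is abelian and by \<open>p \<le> 7/16\<close> if it is not.
\<close>

section \<open>Spectra of disjoint unions of cliques\<close>

text \<open>On each class of \<open>R\<close> the matrix is a block a I + b J, with J the all-ones
  matrix. A class of size m with nonzero sum forces k = a + b m; if all class sums vanish, any
  nonzero coordinate forces k = a.\<close>

lemma integer_eigenvaluesI:
  fixes a :: "nat \<Rightarrow> complex" and b :: complex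
  assumes M: "M \<in> carrier_mat n n"
    and entry: "\<And>i j. i < n \<Longrightarrow> j < n \<Longrightarrow> M $$ (i, j) = (if i = j then a i else 0) + (if R i j then b else 0)"
    and refl: "\<And>i. i < n \<Longrightarrow> R i i"
    and same_class: "\<And>i j k. i < n \<Longrightarrow> j < n \<Longrightarrow> k < n \<Longrightarrow> R i j \<Longrightarrow> R i k = R j k"
    and a_int: "\<And>i. i < n \<Longrightarrow> a i \<in> \<int>"
    and a_class: "\<And>i j. i < n \<Longrightarrow> j < n \<Longrightarrow> R i j \<Longrightarrow> a i = a j"
    and b_int: "b \<in> \<int>"
  shows "integer_eigenvalues M"
  unfolding integer_eigenvalues_def
proof (intro allI impI)
  fix k assume "eigenvalue M k"
  then obtain v where v: "v \<in> carrier_vec n" "v \<noteq> 0\<^sub>v n" and Mv: "M *\<^sub>v v = k \<cdot>\<^sub>v v"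
    using M unfolding eigenvalue_def eigenvector_def by auto
  define cls where "cls i = {j. j < n \<and> R i j}" for i
  define s where "s i = (\<Sum>j\<in>cls i. v $ j)" for i
  have cls_eq: "cls i = cls j" if "i < n" "j < n" "R i j" for i j
    using same_class[OF that(1,2) _ that(3)] by (auto simp: cls_def)
  have row: "a i * v $ i + b * s i = k * v $ i" if i: "i < n" for i
  proof -
    have "k * v $ i = (M *\<^sub>v v) $ i"
      unfolding Mv using v i by auto
    also have "\<dots> = (\<Sum>j<n. M $$ (i, j) * v $ j)"
      using M v i by (auto simp: scalar_prod_def lessThan_atLeast0)
    also have "\<dots> = (\<Sum>j<n. (if i = j then a i * v $ j else 0) + (if R i j then b * v $ j else 0))"
      by (rule sum.cong) (auto simp: entry i distrib_right)
    also have "\<dots> = a i * v $ i + (\<Sum>j<n. if R i j then b * v $ j else 0)"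
      using i by (simp add: sum.distrib)
    also have "(\<Sum>j<n. if R i j then b * v $ j else 0) = (\<Sum>j\<in>cls i. b * v $ j)"
      by (subst sum.inter_filter[symmetric]) (auto simp: cls_def)
    finally show ?thesis
      by (simp add: s_def sum_distrib_left)
  qed
  show "k \<in> \<int>"
  proof (cases "\<exists>i<n. s i \<noteq> 0")
    case True
    then obtain i where i: "i < n" and si: "s i \<noteq> 0"
      by blast
    have "k * s i = (\<Sum>j\<in>cls i. k * v $ j)"
      by (simp add: s_def sum_distrib_left)
    \<comment> \<open>Both \<open>a\<close> and \<open>s\<close> are constant on the class of
      \<open>i\<close>, so its row equations add up to an equation in \<open>s i\<close>
      alone.\<close>
    also have "\<dots> = (\<Sum>j\<in>cls i. a i * v $ j + b * s i)"
    proof (rule sum.cong)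
      fix j assume "j \<in> cls i"
      then have j: "j < n" "R i j"
        by (auto simp: cls_def)
      then show "k * v $ j = a i * v $ j + b * s i"
        using row[OF j(1)] a_class[OF i j] cls_eq[OF i j] by (simp add: s_def)
    qed simp
    also have "\<dots> = (a i + b * of_nat (card (cls i))) * s i"
      by (simp add: s_def sum.distrib sum_distrib_left[symmetric] distrib_right)
    finally have "k = a i + b * of_nat (card (cls i))"
      using si by simp
    then show ?thesis
      using a_int[OF i] b_int by simp
  next
    case False
    obtain i where i: "i < n" "v $ i \<noteq> 0"
      using v by (metis carrier_vecD eq_vecI index_zero_vec)
    then have "k = a i"
      using row[OF i(1)] False by simp
    then show ?thesis
      using a_int[OF i(1)] by simp
  qed
qed

text \<open>The assumption \<open>trans\<close> says that noncentral elements have abelian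
  centralizers. Commuting is then an equivalence relation on the vertices, and its classes are
  cliques with no edges between them.\<close>

lemma super_integral_if_commuting_transitive:
  fixes G :: "('a, 'b) monoid_scheme"
  assumes grp: "group G" "finite (carrier G)" "\<not> comm_group G"
    and trans: "\<And>x y z. \<lbrakk>x \<in> carrier G - group_center G; y \<in> carrier G; z \<in> carrier G;
      x \<otimes>\<^bsub>G\<^esub> y = y \<otimes>\<^bsub>G\<^esub> x; x \<otimes>\<^bsub>G\<^esub> z = z \<otimes>\<^bsub>G\<^esub> x\<rbrakk> \<Longrightarrow> y \<otimes>\<^bsub>G\<^esub> z = z \<otimes>\<^bsub>G\<^esub> y"
  shows "super_integral G"
  unfolding super_integral_def
proof (intro conjI allI impI grp)
  fix vs :: "'a list"
  let ?H = "commuting_graph G"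
  assume vs: "distinct vs \<and> set vs = pverts ?H"
  define n where "n = length vs"
  define V where "V = carrier G - group_center G"
  define R where "R i j \<longleftrightarrow> vs ! i \<otimes>\<^bsub>G\<^esub> vs ! j = vs ! j \<otimes>\<^bsub>G\<^esub> vs ! i" for i j
  define d where "d i = (of_nat (out_degree (with_proj ?H) (vs ! i)) :: complex)" for i
  have V: "set vs = V" "finite V"
    using vs grp by (auto simp: commuting_graph_def V_def)
  have nth: "vs ! i \<in> V" "vs ! i \<in> carrier G" if "i < n" for i
    using that V(1) nth_mem[of i vs] unfolding n_def V_def by blast+
  have edge: "(vs ! i, vs ! j) \<in> parcs ?H \<longleftrightarrow> i \<noteq> j \<and> R i j" if "i < n" "j < n" for i j
    using nth[OF that(1)] nth[OF that(2)] that vs nth_eq_iff_index_eq[of vs i j]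
    by (auto simp: commuting_graph_def V_def[symmetric] R_def n_def)
  have R_refl: "R i i" for i
    by (simp add: R_def)
  have R_class: "R i k = R j k" if "i < n" "j < n" "k < n" "R i j" for i j k
    using trans[of "vs ! i" "vs ! j" "vs ! k"] trans[of "vs ! j" "vs ! i" "vs ! k"] nth that
    unfolding V_def R_def by metis
  \<comment> \<open>Adding one counts the vertex itself, so the right-hand side depends only on the
    clique.\<close>
  have d: "d i + 1 = of_nat (card {u \<in> V. vs ! i \<otimes>\<^bsub>G\<^esub> u = u \<otimes>\<^bsub>G\<^esub> vs ! i})" if i: "i < n" for i
  proof -
    let ?C = "{u \<in> V. vs ! i \<otimes>\<^bsub>G\<^esub> u = u \<otimes>\<^bsub>G\<^esub> vs ! i}"
    have "out_arcs (with_proj ?H) (vs ! i) = Pair (vs ! i) ` (?C - {vs ! i})"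
      using nth[OF i] by (auto simp: out_arcs_def commuting_graph_def V_def)
    then have "out_degree (with_proj ?H) (vs ! i) = card (?C - {vs ! i})"
      by (simp add: out_degree_def card_image inj_on_def)
    then have "Suc (out_degree (with_proj ?H) (vs ! i)) = card ?C"
      using nth[OF i] V(2) card_Suc_Diff1[of ?C "vs ! i"] by simp
    then show ?thesis
      unfolding d_def by (metis of_nat_Suc add.commute)
  qed
  have d_class: "d i = d j" if "i < n" "j < n" "R i j" for i j
  proof -
    have "{u \<in> V. vs ! i \<otimes>\<^bsub>G\<^esub> u = u \<otimes>\<^bsub>G\<^esub> vs ! i} = {u \<in> V. vs ! j \<otimes>\<^bsub>G\<^esub> u = u \<otimes>\<^bsub>G\<^esub> vs ! j}"
    proof (intro Collect_cong conj_cong refl)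
      fix u assume "u \<in> V"
      then show "vs ! i \<otimes>\<^bsub>G\<^esub> u = u \<otimes>\<^bsub>G\<^esub> vs ! i \<longleftrightarrow> vs ! j \<otimes>\<^bsub>G\<^esub> u = u \<otimes>\<^bsub>G\<^esub> vs ! j"
        using trans[of "vs ! i" "vs ! j" u] trans[of "vs ! j" "vs ! i" u] nth that
        unfolding V_def R_def by (metis Diff_iff)
    qed
    then have "d i + 1 = d j + 1"
      using d that by simp
    then show ?thesis
      by simp
  qed
  have d_int: "d i \<in> \<int>" for i
    by (simp add: d_def)
  \<comment> \<open>On a clique the adjacency block is J - I, since \<open>R\<close> is reflexive
    while the graph has no loops. With degree d the Laplacian block is (d + 1) I - J and the
    signless one is (d - 1) I + J.\<close>
  show "integer_eigenvalues (adjacency_matrix ?H vs)"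
    by (rule integer_eigenvaluesI[where n = n and R = R and a = "\<lambda>_. -1" and b = 1, OF _ _ R_refl R_class])
      (auto simp: adjacency_matrix_def edge R_refl n_def[symmetric])
  show "integer_eigenvalues (laplacian_matrix ?H vs)"
    by (rule integer_eigenvaluesI[where n = n and R = R and a = "\<lambda>i. d i + 1" and b = "-1", OF _ _ R_refl R_class])
      (auto simp: laplacian_matrix_def degree_matrix_def adjacency_matrix_def edge R_refl
        n_def[symmetric] d_def[symmetric] d_int intro: d_class)
  show "integer_eigenvalues (signless_laplacian_matrix ?H vs)"
    by (rule integer_eigenvaluesI[where n = n and R = R and a = "\<lambda>i. d i - 1" and b = 1, OF _ _ R_refl R_class])
      (auto simp: signless_laplacian_matrix_def degree_matrix_def adjacency_matrix_def edge R_refl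
        n_def[symmetric] d_def[symmetric] d_int intro: d_class)
qed

section \<open>Centralizers and the commuting probability\<close>

definition centralizer :: "('a, 'b) monoid_scheme \<Rightarrow> 'a \<Rightarrow> 'a set" where
  "centralizer G x = {y \<in> carrier G. x \<otimes>\<^bsub>G\<^esub> y = y \<otimes>\<^bsub>G\<^esub> x}"

text \<open>For a finite group the division is exact by Lagrange's theorem, so this is
  [G : Z(G)].\<close>

definition center_index :: "('a, 'b) monoid_scheme \<Rightarrow> nat" where
  "center_index G = Coset.order G div card (group_center G)"

locale fin_group = group +
  assumes fin: "finite (carrier G)"
begin

lemma commute_mult:
  assumes "x \<in> carrier G" "y \<in> carrier G" "z \<in> carrier G" "x \<otimes> y = y \<otimes> x" "x \<otimes> z = z \<otimes> x"
  shows "x \<otimes> (y \<otimes> z) = (y \<otimes> z) \<otimes> x"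
  using assms by (metis m_assoc)

lemma commute_inv:
  assumes "x \<in> carrier G" "y \<in> carrier G" "x \<otimes> y = y \<otimes> x"
  shows "x \<otimes> inv y = inv y \<otimes> x"
  using assms by (metis inv_closed inv_solve_left inv_solve_right m_assoc m_closed)

lemma centralizer_subgroup: "x \<in> carrier G \<Longrightarrow> subgroup (centralizer G x) G"
  by (rule subgroupI) (auto simp: centralizer_def commute_inv commute_mult intro!: exI[of _ \<one>])

lemma center_subgroup: "subgroup (group_center G) G"
proof (rule subgroupI)
  show "inv a \<in> group_center G" if "a \<in> group_center G" for a
    using that commute_inv[of _ a] by (fastforce simp: group_center_def)
  show "a \<otimes> b \<in> group_center G" if "a \<in> group_center G" "b \<in> group_center G" for a b
    unfolding group_center_def
  proof (intro CollectI conjI ballI)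
    have ab: "a \<in> carrier G" "b \<in> carrier G"
      using that by (auto simp: group_center_def)
    then show "a \<otimes> b \<in> carrier G"
      by simp
    fix x assume x: "x \<in> carrier G"
    then have "x \<otimes> a = a \<otimes> x" "x \<otimes> b = b \<otimes> x"
      using that by (auto simp: group_center_def)
    from commute_mult[OF x ab this] show "a \<otimes> b \<otimes> x = x \<otimes> (a \<otimes> b)"
      by (rule sym)
  qed
qed (auto simp: group_center_def intro!: exI[of _ \<one>])

lemma center_commute: "z \<in> group_center G \<Longrightarrow> x \<in> carrier G \<Longrightarrow> z \<otimes> x = x \<otimes> z"
  by (simp add: group_center_def)

lemma center_sub_carrier: "group_center G \<subseteq> carrier G"
  by (auto simp: group_center_def)

lemma centralizer_sub_carrier: "centralizer G x \<subseteq> carrier G"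
  by (auto simp: centralizer_def)

lemma center_sub_centralizer: "x \<in> carrier G \<Longrightarrow> group_center G \<subseteq> centralizer G x"
  by (auto simp: group_center_def centralizer_def)

lemma centralizer_self: "x \<in> carrier G \<Longrightarrow> x \<in> centralizer G x"
  by (auto simp: centralizer_def)

lemma centralizer_eq_carrier_iff:
  "x \<in> carrier G \<Longrightarrow> centralizer G x = carrier G \<longleftrightarrow> x \<in> group_center G"
  by (auto simp: group_center_def centralizer_def)

lemma finite_subgroup: "subgroup H G \<Longrightarrow> finite H"
  using fin finite_subset subgroup.subset by blast

lemma card_subgroup_pos: "subgroup H G \<Longrightarrow> 0 < card H"
  using finite_subgroup card_gt_0_iff subgroup.one_closed by blast

lemma subgroup_fin_group: "subgroup H G \<Longrightarrow> fin_group (G\<lparr>carrier := H\<rparr>)"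
  by (simp add: fin_group_def fin_group_axioms_def finite_subgroup subgroup_imp_group)

lemma card_subgroup_dvd:
  assumes "subgroup H G" "subgroup K G" "H \<subseteq> K"
  shows "card H dvd card K"
proof -
  have "card (rcosets\<^bsub>G\<lparr>carrier := K\<rparr>\<^esub> H) * card H = Coset.order (G\<lparr>carrier := K\<rparr>)"
    using group.lagrange[OF subgroup_imp_group[OF assms(2)] subgroup_incl[OF assms]] .
  then have "card K = card (rcosets\<^bsub>G\<lparr>carrier := K\<rparr>\<^esub> H) * card H"
    by (simp add: Coset.order_def)
  then show ?thesis
    by (rule dvdI[where k = "card (rcosets\<^bsub>G\<lparr>carrier := K\<rparr>\<^esub> H)", OF trans[OF _ mult.commute]])
qed

lemma card_proper_subgroup:
  assumes "subgroup H G" "subgroup K G" "H \<subset> K"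
  obtains j where "2 \<le> j" "card K = j * card H"
proof -
  obtain j where j: "card K = j * card H"
    using card_subgroup_dvd[of H K] assms by (metis dvd_def mult.commute psubsetE)
  have "card H < card K"
    using assms by (simp add: finite_subgroup psubset_card_mono)
  then have "j \<noteq> 0" "j \<noteq> 1"
    using j by auto
  then show ?thesis
    using that[of j] j by linarith
qed

lemma subgroup_carrier: "subgroup (carrier G) G"
  by (rule subgroup_self)

lemma order_center_index: "Coset.order G = center_index G * card (group_center G)"
  using card_subgroup_dvd[OF center_subgroup subgroup_carrier center_sub_carrier]
  by (simp add: center_index_def Coset.order_def)

lemma order_pos: "0 < Coset.order G"
  using fin order_gt_0_iff_finite by blast

lemma center_index_pos: "0 < center_index G"
  using order_center_index order_pos by (metis mult_0 not_gr0)

lemma card_center_pos: "0 < card (group_center G)"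
  by (rule card_subgroup_pos[OF center_subgroup])

section \<open>Commuting pairs and upper bounds on the commuting probability\<close>

lemma commuting_prob_eq:
  "commuting_prob G = real (\<Sum>x\<in>carrier G. card (centralizer G x)) / (real (Coset.order G))\<^sup>2"
proof -
  have "{(x, y) \<in> carrier G \<times> carrier G. x \<otimes> y = y \<otimes> x} = Sigma (carrier G) (centralizer G)"
    by (auto simp: centralizer_def)
  then show ?thesis
    unfolding commuting_prob_def using fin
    by (simp add: card_SigmaI finite_subset[OF centralizer_sub_carrier])
qed

lemma sum_centralizers:
  "real (\<Sum>x\<in>carrier G. card (centralizer G x)) = commuting_prob G * (real (Coset.order G))\<^sup>2"
  using order_pos by (simp add: commuting_prob_eq)

lemma card_centralizer_central: "x \<in> group_center G \<Longrightarrow> card (centralizer G x) = Coset.order G"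
  using centralizer_eq_carrier_iff[of x] center_sub_carrier by (auto simp: Coset.order_def)

text \<open>The chain Z(G) < C(x) < G is strict at both ends: \<open>x\<close> lies in C(x) but not
  in Z(G), and C(x) = G would make \<open>x\<close> central.\<close>

lemma noncentral_centralizer:
  assumes "x \<in> carrier G - group_center G"
  obtains j l where "2 \<le> j" "2 \<le> l" "Coset.order G = j * card (centralizer G x)"
    "card (centralizer G x) = l * card (group_center G)" "center_index G = j * l"
proof -
  have x: "x \<in> carrier G"
    using assms by blast
  have "centralizer G x \<subset> carrier G"
    using centralizer_eq_carrier_iff[OF x] assms centralizer_sub_carrier[of x] by blast
  then obtain j where j: "2 \<le> j" "Coset.order G = j * card (centralizer G x)"
    using card_proper_subgroup[OF centralizer_subgroup[OF x] subgroup_carrier] by (metis Coset.order_def)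
  have "group_center G \<subset> centralizer G x"
    using center_sub_centralizer[OF x] centralizer_self[OF x] assms by blast
  then obtain l where l: "2 \<le> l" "card (centralizer G x) = l * card (group_center G)"
    using card_proper_subgroup[OF center_subgroup centralizer_subgroup[OF x]] by metis
  have "center_index G = j * l"
    unfolding center_index_def j(2) l(2) using card_center_pos by simp
  then show ?thesis
    using that j l by blast
qed

text \<open>Central elements contribute |G| commuting pairs each and the others at most |G|/k;
  central elements make up the fraction 1/n of the group, where n is the index of the
  center.\<close>

lemma commuting_prob_le:
  assumes k: "\<And>x. x \<in> carrier G - group_center G \<Longrightarrow> k * card (centralizer G x) \<le> Coset.order G"
    and "0 < k"
  shows "commuting_prob G \<le> 1 / k + (1 - 1 / k) / center_index G"
proof -
  let ?g = "real (Coset.order G)" and ?z = "real (card (group_center G))"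
  have Z: "carrier G \<inter> group_center G = group_center G" "finite (group_center G)"
    using center_sub_carrier fin finite_subset by auto
  have "(\<Sum>x\<in>carrier G. card (centralizer G x))
      = (\<Sum>x\<in>group_center G. card (centralizer G x)) + (\<Sum>x\<in>carrier G - group_center G. card (centralizer G x))"
    using sum.subset_diff[OF center_sub_carrier fin] by (simp add: add.commute)
  then have "real (\<Sum>x\<in>carrier G. card (centralizer G x))
      = ?z * ?g + (\<Sum>x\<in>carrier G - group_center G. real (card (centralizer G x)))"
    by (simp add: card_centralizer_central)
  also have "(\<Sum>x\<in>carrier G - group_center G. real (card (centralizer G x)))
      \<le> (\<Sum>x\<in>carrier G - group_center G. ?g / k)"
  proof (rule sum_mono)
    fix x assume "x \<in> carrier G - group_center G"
    from k[OF this] show "real (card (centralizer G x)) \<le> ?g / k"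
      using \<open>0 < k\<close> by (simp add: field_simps flip: of_nat_mult)
  qed
  also have "\<dots> = (?g - ?z) * (?g / k)"
    using Z center_sub_carrier fin
    by (simp add: card_Diff_subset Coset.order_def of_nat_diff card_mono)
  finally have "commuting_prob G * ?g\<^sup>2 \<le> ?z * ?g + (?g - ?z) * (?g / k)"
    using sum_centralizers by linarith
  also have "\<dots> = (1 / k + (1 - 1 / k) / center_index G) * ?g\<^sup>2"
    using order_center_index card_center_pos center_index_pos \<open>0 < k\<close>
    by (simp add: field_simps power2_eq_square)
  finally show ?thesis
    using order_pos by simp
qed

lemma commuting_prob_le_half: "commuting_prob G \<le> 1 / 2 + 1 / (2 * center_index G)"
proof -
  have "2 * card (centralizer G x) \<le> Coset.order G" if x: "x \<in> carrier G - group_center G" for x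
  proof -
    obtain j l where "2 \<le> j" "2 \<le> l" "Coset.order G = j * card (centralizer G x)"
      "card (centralizer G x) = l * card (group_center G)" "center_index G = j * l"
      using x by (rule noncentral_centralizer)
    then show ?thesis
      using mult_le_mono1[of 2 j] by simp
  qed
  from commuting_prob_le[of 2, OF this] show ?thesis
    by simp
qed

lemma commuting_prob_le_third:
  assumes "\<And>x. x \<in> carrier G - group_center G \<Longrightarrow> Coset.order G \<noteq> 2 * card (centralizer G x)"
  shows "commuting_prob G \<le> 1 / 3 + 2 / (3 * center_index G)"
proof -
  have "3 * card (centralizer G x) \<le> Coset.order G" if x: "x \<in> carrier G - group_center G" for x
  proof -
    obtain j l where j: "2 \<le> j" "2 \<le> l" "Coset.order G = j * card (centralizer G x)"
      "card (centralizer G x) = l * card (group_center G)" "center_index G = j * l"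
      using x by (rule noncentral_centralizer)
    then have "j \<noteq> 2"
      using assms[OF x] by auto
    then have "3 \<le> j"
      using j(1) by simp
    then show ?thesis
      using j(3) mult_le_mono1 by simp
  qed
  from commuting_prob_le[of 3, OF this] show ?thesis
    by simp
qed

lemma abelian_iff: "comm_group G \<longleftrightarrow> carrier G = group_center G"
proof
  show "comm_group G \<Longrightarrow> carrier G = group_center G"
    by (auto simp: group_center_def comm_group_def comm_monoid.m_comm)
  show "comm_group G" if "carrier G = group_center G"
  proof (rule group_comm_groupI)
    fix x y assume "x \<in> carrier G" "y \<in> carrier G"
    then show "x \<otimes> y = y \<otimes> x"
      using that center_commute by blast
  qed
qed

lemma abelian_center_index: "comm_group G \<Longrightarrow> center_index G = 1"
  using card_center_pos by (simp add: abelian_iff center_index_def Coset.order_def)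

lemma abelian_commuting_prob: "comm_group G \<Longrightarrow> commuting_prob G = 1"
  using sum_centralizers order_pos card_centralizer_central
  by (simp add: abelian_iff Coset.order_def power2_eq_square)

lemma nonabelian_obtain:
  assumes "\<not> comm_group G"
  obtains x where "x \<in> carrier G - group_center G"
  using assms abelian_iff center_sub_carrier by blast

lemma nonabelian_center_index:
  assumes "\<not> comm_group G"
  obtains j l where "2 \<le> j" "2 \<le> l" "center_index G = j * l"
proof -
  obtain x where "x \<in> carrier G - group_center G"
    using assms by (rule nonabelian_obtain)
  then obtain j l where "2 \<le> j" "2 \<le> l" "Coset.order G = j * card (centralizer G x)"
    "card (centralizer G x) = l * card (group_center G)" "center_index G = j * l"
    by (rule noncentral_centralizer)
  then show ?thesis
    using that by blast
qed

lemma nonabelian_center_index_ge: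
  assumes "\<not> comm_group G"
  shows "4 \<le> center_index G"
proof -
  obtain j l where "2 \<le> j" "2 \<le> l" "center_index G = j * l"
    using assms by (rule nonabelian_center_index)
  then show ?thesis
    using mult_le_mono[of 2 j 2 l] by simp
qed

text \<open>A noncentral centralizer strictly between Z(G) and G splits the index into two proper
  factors; for abelian groups the index is 1.\<close>

lemma center_index_not_prime: "\<not> prime (center_index G)"
proof
  assume p: "prime (center_index G)"
  then have "\<not> comm_group G"
    using abelian_center_index by fastforce
  then obtain j l where "2 \<le> j" "2 \<le> l" "center_index G = j * l"
    by (rule nonabelian_center_index)
  then show False
    using p prime_product[of j l] by auto
qed

lemma commuting_prob_le_5_8: "\<not> comm_group G \<Longrightarrow> commuting_prob G \<le> 5 / 8"
proof -
  assume "\<not> comm_group G"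
  then have "1 / (2 * real (center_index G)) \<le> 1 / 8"
    using nonabelian_center_index_ge by (simp add: field_simps)
  then show ?thesis
    using commuting_prob_le_half by linarith
qed

section \<open>Integrality of the commuting probability times the squared index of the
  center\<close>

lemma card_dvd_if_closed:
  assumes N: "subgroup N G" and S: "S \<subseteq> carrier G"
    and closed: "\<And>z s. z \<in> N \<Longrightarrow> s \<in> S \<Longrightarrow> z \<otimes> s \<in> S"
  shows "card N dvd card S"
proof -
  \<comment> \<open>Closure under \<open>N\<close> makes \<open>S\<close> a disjoint union of right
    cosets of \<open>N\<close>.\<close>
  have S_eq: "S = \<Union> ((\<lambda>s. N #> s) ` S)"
  proof
    show "S \<subseteq> \<Union> ((\<lambda>s. N #> s) ` S)"
      using S rcos_self[OF _ N] by blast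
    show "\<Union> ((\<lambda>s. N #> s) ` S) \<subseteq> S"
      using closed unfolding r_coset_def by blast
  qed
  have rc: "C \<in> rcosets N" if "C \<in> (\<lambda>s. N #> s) ` S" for C
    using that S rcosetsI[OF subgroup.subset[OF N]] by blast
  have "card N dvd card (\<Union> ((\<lambda>s. N #> s) ` S))"
  proof (rule dvd_partition)
    show "finite (\<Union> ((\<lambda>s. N #> s) ` S))"
      using S_eq S fin finite_subset by metis
    show "\<forall>C\<in>(\<lambda>s. N #> s) ` S. card N dvd card C"
      using card_cosets_equal[OF rc subgroup.subset[OF N]] bij_betw_same_card by (metis dvd_refl)
    show "\<forall>C\<in>(\<lambda>s. N #> s) ` S. \<forall>D\<in>(\<lambda>s. N #> s) ` S. C \<noteq> D \<longrightarrow> C \<inter> D = {}"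
      using rc rcos_disjoint[OF N] by (meson pairwiseD disjnt_def)
  qed
  then show ?thesis
    using S_eq by simp
qed

lemma centralizer_center_mult:
  assumes "z \<in> group_center G" "x \<in> carrier G"
  shows "centralizer G (z \<otimes> x) = centralizer G x"
proof -
  have z: "z \<in> carrier G"
    using assms center_sub_carrier by blast
  have "(z \<otimes> x) \<otimes> y = y \<otimes> (z \<otimes> x) \<longleftrightarrow> x \<otimes> y = y \<otimes> x" if y: "y \<in> carrier G" for y
  proof -
    have "y \<otimes> (z \<otimes> x) = z \<otimes> (y \<otimes> x)"
      using assms y z center_commute m_assoc by metis
    then show ?thesis
      using assms y z by (simp add: m_assoc)
  qed
  then show ?thesis
    by (auto simp: centralizer_def)
qed

text \<open>Group the elements by centralizer order \<open>d\<close>. Each group is a union of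
  cosets of the center, and \<open>d\<close> is itself a multiple of the order of the center, so
  every summand carries that order twice.\<close>

lemma center_sq_dvd_commuting_pairs:
  "(card (group_center G))\<^sup>2 dvd (\<Sum>x\<in>carrier G. card (centralizer G x))"
proof -
  let ?Z = "group_center G"
  define f where "f x = card (centralizer G x)" for x
  have level: "card ?Z dvd card {x \<in> carrier G. f x = d}" for d
    by (rule card_dvd_if_closed[OF center_subgroup])
      (use center_sub_carrier in \<open>auto simp: f_def centralizer_center_mult\<close>)
  have "(\<Sum>x\<in>carrier G. f x) = (\<Sum>d\<in>f ` carrier G. \<Sum>x | x \<in> carrier G \<and> f x = d. f x)"
    using sum.image_gen[OF fin] by blast
  also have "\<dots> = (\<Sum>d\<in>f ` carrier G. card {x \<in> carrier G. f x = d} * d)"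
    by (intro sum.cong refl) simp
  finally have eq: "(\<Sum>x\<in>carrier G. f x) = (\<Sum>d\<in>f ` carrier G. card {x \<in> carrier G. f x = d} * d)" .
  have "card ?Z dvd d" if "d \<in> f ` carrier G" for d
    using that card_subgroup_dvd[OF center_subgroup centralizer_subgroup center_sub_centralizer]
    by (auto simp: f_def)
  then have "(card ?Z)\<^sup>2 dvd (\<Sum>d\<in>f ` carrier G. card {x \<in> carrier G. f x = d} * d)"
    unfolding power2_eq_square by (intro dvd_sum mult_dvd_mono level)
  then show ?thesis
    using eq by (simp add: f_def)
qed

lemma commuting_prob_center_index:
  obtains m :: nat where "commuting_prob G * (real (center_index G))\<^sup>2 = real m"
proof -
  obtain m where m: "(\<Sum>x\<in>carrier G. card (centralizer G x)) = (card (group_center G))\<^sup>2 * m"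
    using center_sq_dvd_commuting_pairs by (auto elim: dvdE)
  have "commuting_prob G * (real (center_index G))\<^sup>2 = real m"
    unfolding commuting_prob_eq m order_center_index
    using card_center_pos center_index_pos by (simp add: power_mult_distrib field_simps)
  then show ?thesis
    by (rule that)
qed

end

section \<open>Centralizers of index two\<close>

lemma card_le_fibres:
  assumes "finite S" "finite T" "f ` S \<subseteq> T" "\<And>t. t \<in> T \<Longrightarrow> card {s \<in> S. f s = t} \<le> m"
  shows "card S \<le> card T * m"
proof -
  have "card S = card (\<Union>t\<in>T. {s \<in> S. f s = t})"
    using assms(3) by (intro arg_cong[where f = card]) auto
  also have "\<dots> \<le> (\<Sum>t\<in>T. card {s \<in> S. f s = t})"
    using assms(2) by (rule card_UN_le)
  also have "\<dots> \<le> card T * m"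
    using sum_bounded_above[of T "\<lambda>t. card {s \<in> S. f s = t}" m] assms(4) by simp
  finally show ?thesis .
qed

context fin_group begin

lemma mult_notin_subgroup:
  assumes "subgroup H G" "a \<in> H" "y \<in> carrier G" "y \<notin> H"
  shows "a \<otimes> y \<notin> H" "y \<otimes> a \<notin> H"
proof -
  have a: "a \<in> carrier G" "inv a \<in> H"
    using assms subgroup.mem_carrier subgroup.m_inv_closed by metis+
  show "a \<otimes> y \<notin> H"
  proof
    assume "a \<otimes> y \<in> H"
    then have "inv a \<otimes> (a \<otimes> y) \<in> H"
      using a assms(1) subgroup.m_closed by metis
    then show False
      using a assms by (simp add: m_assoc[symmetric])
  qed
  show "y \<otimes> a \<notin> H"
  proof
    assume "y \<otimes> a \<in> H"
    then have "(y \<otimes> a) \<otimes> inv a \<in> H"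
      using a assms(1) subgroup.m_closed by metis
    then show False
      using a assms by (simp add: m_assoc)
  qed
qed

text \<open>By counting, right multiplication by \<open>inv y\<close> maps \<open>H\<close> onto
  \<open>K - H\<close>. The ambient subgroup \<open>K\<close> is kept general because the lemma
  serves both A in G and Z(G) in Z(A).\<close>

lemma index_two_mult:
  assumes H: "subgroup H G" and K: "subgroup K G" and sub: "H \<subseteq> K" and card: "card K = 2 * card H"
    and x: "x \<in> K - H" and y: "y \<in> K - H"
  shows "x \<otimes> y \<in> H"
proof -
  have carr: "x \<in> carrier G" "y \<in> carrier G" "inv y \<in> K"
    using x y K subgroup.mem_carrier subgroup.m_inv_closed by (metis DiffD1)+
  have iy: "inv y \<in> carrier G"
    using carr by simp
  have iyH: "inv y \<notin> H"
    using carr y subgroup.m_inv_closed[OF H, of "inv y"] by auto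
  let ?f = "\<lambda>a. a \<otimes> inv y"
  have inj: "inj_on ?f H"
    by (rule inj_onI) (simp add: iy subgroup.mem_carrier[OF H])
  have img: "?f ` H \<subseteq> K - H"
    using mult_notin_subgroup(1)[OF H _ iy iyH] subgroup.m_closed[OF K _ carr(3)] sub by blast
  have "card (K - H) = card H"
    using card sub by (simp add: card_Diff_subset finite_subgroup[OF H])
  then have "?f ` H = K - H"
    using img by (intro card_subset_eq) (simp_all add: finite_subgroup[OF K] card_image[OF inj])
  then obtain a where a: "a \<in> H" "x = a \<otimes> inv y"
    using x by blast
  then have "x \<otimes> y = a"
    using carr H subgroup.mem_carrier by (simp add: m_assoc subgroup.mem_carrier)
  then show ?thesis
    using a by simp
qed

lemma index_two_conj:
  assumes A: "subgroup A G" and card: "Coset.order G = 2 * card A"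
    and y: "y \<in> carrier G" and a: "a \<in> A"
  shows "y \<otimes> a \<otimes> inv y \<in> A"
proof (cases "y \<in> A")
  case True
  then show ?thesis
    using A a subgroup.m_closed subgroup.m_inv_closed by metis
next
  case False
  have "inv y \<notin> A"
    using False A y subgroup.m_inv_closed by (metis inv_inv)
  then show ?thesis
    using index_two_mult[OF A subgroup_carrier subgroup.subset[OF A], of "y \<otimes> a" "inv y"]
      mult_notin_subgroup(2)[OF A a y False] card y subgroup.mem_carrier[OF A a]
    by (simp add: Coset.order_def)
qed

text \<open>\<open>A\<close> and \<open>y\<close> generate the group: any \<open>g\<close> outside
  \<open>A\<close> is \<open>(g \<otimes> inv y) \<otimes> y\<close> with first factor in
  \<open>A\<close>.\<close>

lemma index_two_central:
  assumes A: "subgroup A G" and card: "Coset.order G = 2 * card A"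
    and y: "y \<in> carrier G - A" and z: "z \<in> carrier G"
    and commute: "\<And>a. a \<in> A \<Longrightarrow> z \<otimes> a = a \<otimes> z" "z \<otimes> y = y \<otimes> z"
  shows "z \<in> group_center G"
proof -
  have "z \<otimes> g = g \<otimes> z" if g: "g \<in> carrier G" for g
  proof (cases "g \<in> A")
    case True
    then show ?thesis
      by (rule commute(1))
  next
    case False
    have iy: "inv y \<in> carrier G - A"
      using y A subgroup.m_inv_closed by (metis Diff_iff inv_closed inv_inv)
    have gA: "g \<otimes> inv y \<in> A"
      using index_two_mult[OF A subgroup_carrier subgroup.subset[OF A], of g "inv y"] card g False iy
      by (simp add: Coset.order_def)
    have "z \<otimes> ((g \<otimes> inv y) \<otimes> y) = ((g \<otimes> inv y) \<otimes> y) \<otimes> z"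
      using commute_mult[OF z _ _ commute(1)[OF gA] commute(2)] g y by simp
    moreover have "(g \<otimes> inv y) \<otimes> y = g"
      using g y by (simp add: m_assoc)
    ultimately show ?thesis
      by simp
  qed
  then show ?thesis
    using z by (simp add: group_center_def)
qed

text \<open>Split the pairs by membership in \<open>A\<close>. The two mixed kinds are equally many
  by symmetry, and the pairs with both entries outside \<open>A\<close> are at most as many as one
  mixed kind, hence the factor 3.\<close>

lemma index_two_commuting_pairs:
  assumes A: "subgroup A G" and card: "Coset.order G = 2 * card A"
  shows "(\<Sum>x\<in>carrier G. card (centralizer G x))
    \<le> (\<Sum>a\<in>A. card (centralizer G a \<inter> A)) + 3 * (\<Sum>y\<in>carrier G - A. card (centralizer G y \<inter> A))"
proof -
  have finC: "finite (centralizer G x)" for x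
    using centralizer_sub_carrier fin finite_subset by metis
  have A_sub: "A \<subseteq> carrier G" and finA: "finite A"
    using A subgroup.subset finite_subgroup by blast+
  have "(\<Sum>x\<in>carrier G. card (centralizer G x))
      = (\<Sum>a\<in>A. card (centralizer G a)) + (\<Sum>y\<in>carrier G - A. card (centralizer G y))"
    using sum.subset_diff[OF A_sub fin] by (simp add: add.commute)
  moreover have "(\<Sum>a\<in>A. card (centralizer G a))
      = (\<Sum>a\<in>A. card (centralizer G a \<inter> A)) + (\<Sum>y\<in>carrier G - A. card (centralizer G y \<inter> A))"
  proof -
    have "card (centralizer G a)
        = card (centralizer G a \<inter> A) + card {y \<in> carrier G - A. a \<otimes> y = y \<otimes> a}" for a
    proof -
      have "centralizer G a = (centralizer G a \<inter> A) \<union> {y \<in> carrier G - A. a \<otimes> y = y \<otimes> a}"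
        by (auto simp: centralizer_def)
      then show ?thesis
        using card_Un_disjoint[of "centralizer G a \<inter> A" "{y \<in> carrier G - A. a \<otimes> y = y \<otimes> a}"]
          finC fin by auto
    qed
    then have "(\<Sum>a\<in>A. card (centralizer G a)) = (\<Sum>a\<in>A. card (centralizer G a \<inter> A))
        + (\<Sum>a\<in>A. card {y \<in> carrier G - A. a \<otimes> y = y \<otimes> a})"
      by (simp add: sum.distrib)
    also have "(\<Sum>a\<in>A. card {y \<in> carrier G - A. a \<otimes> y = y \<otimes> a})
        = (\<Sum>y\<in>carrier G - A. card {a \<in> A. a \<otimes> y = y \<otimes> a})"
      using sum.swap_restrict[OF finA, of "carrier G - A" "\<lambda>_ _. 1::nat" "\<lambda>a y. a \<otimes> y = y \<otimes> a"] fin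
      by simp
    also have "\<dots> = (\<Sum>y\<in>carrier G - A. card (centralizer G y \<inter> A))"
      using A_sub by (intro sum.cong refl arg_cong[where f = card]) (auto simp: centralizer_def)
    finally show ?thesis .
  qed
  moreover have "(\<Sum>y\<in>carrier G - A. card (centralizer G y))
      \<le> (\<Sum>y\<in>carrier G - A. 2 * card (centralizer G y \<inter> A))"
  proof (rule sum_mono)
    fix y assume y: "y \<in> carrier G - A"
    have C: "subgroup (centralizer G y) G"
      using y by (simp add: centralizer_subgroup)
    \<comment> \<open>Right multiplication by \<open>y\<close> moves C(y) - A into C(y) \<inter> A,
      as a product of two elements outside \<open>A\<close> lies in \<open>A\<close>.\<close>
    have "card (centralizer G y - A) \<le> card (centralizer G y \<inter> A)"
    proof (rule card_inj_on_le)
      show "inj_on (\<lambda>h. h \<otimes> y) (centralizer G y - A)"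
        using y by (intro inj_onI) (simp add: centralizer_def)
      show "(\<lambda>h. h \<otimes> y) ` (centralizer G y - A) \<subseteq> centralizer G y \<inter> A"
      proof
        fix w assume "w \<in> (\<lambda>h. h \<otimes> y) ` (centralizer G y - A)"
        then obtain h where h: "h \<in> centralizer G y" "h \<notin> A" "w = h \<otimes> y"
          by blast
        moreover have "h \<otimes> y \<in> centralizer G y"
          using h(1) y centralizer_self subgroup.m_closed[OF C] by blast
        moreover have "h \<otimes> y \<in> A"
          using index_two_mult[OF A subgroup_carrier A_sub, of h y] card h y centralizer_sub_carrier[of y]
          by (auto simp: Coset.order_def)
        ultimately show "w \<in> centralizer G y \<inter> A"
          by blast
      qed
    qed (simp add: finC)
    moreover have "card (centralizer G y) = card (centralizer G y \<inter> A) + card (centralizer G y - A)"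
      using finC by (metis card_Int_Diff)
    ultimately show "card (centralizer G y) \<le> 2 * card (centralizer G y \<inter> A)"
      by simp
  qed
  ultimately show ?thesis
    by (simp add: sum_distrib_left[symmetric])
qed

lemma center_of_subgroup:
  "group_center (G\<lparr>carrier := A\<rparr>) = {z \<in> A. \<forall>a\<in>A. z \<otimes> a = a \<otimes> z}"
  by (simp add: group_center_def)

text \<open>For \<open>y \<notin> A\<close> the group \<open>Z(A)\<close> meets the centralizer of \<open>y\<close> only in \<open>Z(G)\<close>, so
  \<open>C(y) \<inter> A\<close> has index at least \<open>r = [Z(A) : Z(G)]\<close> in \<open>A\<close>.\<close>

lemma index_two_centralizer:
  assumes x: "x \<in> carrier G - group_center G" and card: "Coset.order G = 2 * card (centralizer G x)"
  defines "A \<equiv> centralizer G x"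
  obtains r where "2 \<le> r" "card (group_center (G\<lparr>carrier := A\<rparr>)) = r * card (group_center G)"
    "center_index G = 2 * r * center_index (G\<lparr>carrier := A\<rparr>)"
    "commuting_prob G \<le> commuting_prob (G\<lparr>carrier := A\<rparr>) / 4 + 3 / (4 * real r)"
proof -
  let ?Z = "group_center G" and ?GA = "G\<lparr>carrier := A\<rparr>"
  let ?ZA = "group_center ?GA"
  have A: "subgroup A G" and A_sub: "A \<subseteq> carrier G" and finA: "finite A"
    using x centralizer_subgroup subgroup.subset finite_subgroup unfolding A_def by blast+
  have cardA: "Coset.order G = 2 * card A"
    using card A_def by simp
  interpret A: fin_group ?GA
    by (rule subgroup_fin_group[OF A])
  have ZA: "subgroup ?ZA G"
    using A.center_subgroup A incl_subgroup by blast
  have ZA_sub: "?ZA \<subseteq> A"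
    using A.center_sub_carrier by simp
  have "?Z \<subset> ?ZA"
  proof
    show "?Z \<subseteq> ?ZA"
      using A_sub center_commute center_sub_centralizer[of x] x
      unfolding center_of_subgroup by (auto simp: A_def)
    have "x \<in> ?ZA"
      using x centralizer_self unfolding center_of_subgroup by (auto simp: A_def centralizer_def)
    then show "?Z \<noteq> ?ZA"
      using x by blast
  qed
  then obtain r where r: "2 \<le> r" "card ?ZA = r * card ?Z"
    using card_proper_subgroup[OF center_subgroup ZA] by metis
  have order_A: "Coset.order ?GA = card A"
    by (simp add: Coset.order_def)
  have "center_index G * card ?Z = (2 * r * center_index ?GA) * card ?Z"
  proof -
    have "card A = center_index ?GA * (r * card ?Z)"
      using A.order_center_index order_A r by simp
    then show ?thesis
      using order_center_index cardA by (simp only: mult_ac)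
  qed
  then have index: "center_index G = 2 * r * center_index ?GA"
    using card_center_pos by simp
  have inter: "centralizer G y \<inter> ?ZA \<subseteq> ?Z" if y: "y \<in> carrier G - A" for y
  proof
    fix z assume z: "z \<in> centralizer G y \<inter> ?ZA"
    then have "z \<in> carrier G" "z \<otimes> y = y \<otimes> z"
      by (auto simp: centralizer_def)
    then show "z \<in> ?Z"
      using index_two_central[OF A cardA y] z unfolding center_of_subgroup by blast
  qed
  have bound: "card (centralizer G y \<inter> A) * r \<le> card A" if y: "y \<in> carrier G - A" for y
  proof -
    let ?K = "centralizer G y \<inter> A"
    have K: "subgroup ?K G"
      using subgroups_Inter_pair[OF centralizer_subgroup A] y by blast
    \<comment> \<open>Multiplication maps this product into \<open>A\<close>; its fibres are no
      larger than Z(G), which bounds the order of \<open>?K\<close>.\<close>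
    have "card (?K \<times> ?ZA) \<le> card A * card ?Z"
    proof (rule card_le_fibres[where f = "\<lambda>(u, v). u \<otimes> v"])
      show "finite (?K \<times> ?ZA)"
        using finite_subgroup K ZA by blast
      show "finite A"
        by (rule finA)
      show "(\<lambda>(u, v). u \<otimes> v) ` (?K \<times> ?ZA) \<subseteq> A"
        using subgroup.m_closed[OF A] ZA_sub by auto
      fix w assume "w \<in> A"
      let ?F = "{s \<in> ?K \<times> ?ZA. (case s of (u, v) \<Rightarrow> u \<otimes> v) = w}"
      show "card ?F \<le> card ?Z"
      proof (cases "?F = {}")
        case True
        show ?thesis
          unfolding True by simp
      next
        case False
        then obtain u0 v0 where 0: "u0 \<in> ?K" "v0 \<in> ?ZA" "u0 \<otimes> v0 = w"
          by auto
        have c0: "u0 \<in> carrier G" "v0 \<in> carrier G"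
          using subgroup.mem_carrier[OF K 0(1)] subgroup.mem_carrier[OF ZA 0(2)] by simp_all
        show ?thesis
        proof (rule card_inj_on_le)
          show "inj_on (\<lambda>(u, v). inv u0 \<otimes> u) ?F"
          proof (rule inj_onI, clarify)
            fix u v u' v'
            assume uv: "u \<in> centralizer G y" "u \<in> A" "v \<in> ?ZA" "w = u \<otimes> v"
              and uv': "u' \<in> centralizer G y" "u' \<in> A" "v' \<in> ?ZA" "u' \<otimes> v' = u \<otimes> v"
              and eq: "inv u0 \<otimes> u = inv u0 \<otimes> u'"
            have c: "u \<in> carrier G" "u' \<in> carrier G" "v \<in> carrier G" "v' \<in> carrier G"
              using uv uv' A_sub ZA_sub by blast+
            then have "u = u'"
              using eq c0 by simp
            moreover have "v = v'"
              using uv'(4) c \<open>u = u'\<close> by simp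
            ultimately show "u = u' \<and> v = v'"
              by simp
          qed
          \<comment> \<open>Two factorizations of \<open>w\<close> give
            \<open>inv u0 \<otimes> u = v0 \<otimes> inv v\<close>, an element of both C(y) and
            Z(A), hence of Z(G).\<close>
          show "(\<lambda>(u, v). inv u0 \<otimes> u) ` ?F \<subseteq> ?Z"
          proof clarify
            fix u v assume uv: "u \<in> centralizer G y" "u \<in> A" "v \<in> ?ZA" "w = u \<otimes> v"
            have c: "u \<in> carrier G" "v \<in> carrier G"
              using uv A_sub ZA_sub by blast+
            have "u0 \<otimes> v0 = u \<otimes> v"
              using 0 uv by simp
            then have "inv u0 \<otimes> (u0 \<otimes> v0) \<otimes> inv v = inv u0 \<otimes> (u \<otimes> v) \<otimes> inv v"
              by simp
            then have "v0 \<otimes> inv v = inv u0 \<otimes> u"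
              using c c0 by (simp add: m_assoc[symmetric]) (simp add: m_assoc)
            moreover have "v0 \<otimes> inv v \<in> ?ZA"
              using subgroup.m_closed[OF ZA 0(2) subgroup.m_inv_closed[OF ZA uv(3)]] .
            moreover have "inv u0 \<otimes> u \<in> ?K"
              using 0(1) uv(1,2) subgroup.m_closed[OF K] subgroup.m_inv_closed[OF K] by blast
            ultimately show "inv u0 \<otimes> u \<in> ?Z"
              using inter[OF y] by auto
          qed
        qed (use finite_subgroup center_subgroup in blast)
      qed
    qed
    then have "(card ?K * r) * card ?Z \<le> card A * card ?Z"
      by (simp add: card_cartesian_product r)
    then show ?thesis
      using card_center_pos by simp
  qed
  define s where "s = (\<Sum>a\<in>A. card (centralizer G a \<inter> A))"
  define t where "t = (\<Sum>y\<in>carrier G - A. card (centralizer G y \<inter> A))"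
  have "centralizer ?GA a = centralizer G a \<inter> A" for a
    using A_sub by (auto simp: centralizer_def)
  then have s: "real s = commuting_prob ?GA * (real (card A))\<^sup>2"
    using A.sum_centralizers by (simp add: s_def Coset.order_def)
  have "t * r = (\<Sum>y\<in>carrier G - A. card (centralizer G y \<inter> A) * r)"
    by (simp add: t_def sum_distrib_right)
  also have "\<dots> \<le> (\<Sum>y\<in>carrier G - A. card A)"
    by (rule sum_mono) (rule bound)
  also have "\<dots> = card A * card A"
    using cardA A_sub by (simp add: card_Diff_subset finA Coset.order_def)
  finally have "real (t * r) \<le> real (card A * card A)"
    by (simp only: of_nat_le_iff)
  then have t: "real t \<le> (real (card A))\<^sup>2 / r"
    using r(1) by (simp add: field_simps power2_eq_square)
  have "(\<Sum>x\<in>carrier G. card (centralizer G x)) \<le> s + 3 * t"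
    using index_two_commuting_pairs[OF A cardA] by (simp add: s_def t_def)
  then have "real (\<Sum>x\<in>carrier G. card (centralizer G x)) \<le> real (s + 3 * t)"
    by (simp only: of_nat_le_iff)
  then have "commuting_prob G * (2 * real (card A))\<^sup>2 \<le> commuting_prob ?GA * (real (card A))\<^sup>2 + 3 * ((real (card A))\<^sup>2 / r)"
    using s t sum_centralizers cardA by simp
  then have "commuting_prob G * (2 * real (card A))\<^sup>2 \<le> (commuting_prob ?GA / 4 + 3 / (4 * real r)) * (2 * real (card A))\<^sup>2"
    by (simp add: power_mult_distrib field_simps)
  then have "commuting_prob G \<le> commuting_prob ?GA / 4 + 3 / (4 * real r)"
    using card_subgroup_pos[OF A] by simp
  then show ?thesis
    by (rule that[OF r index])
qed

end

section \<open>Quotients by a central involution\<close>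

text \<open>For central \<open>c\<close> these are the elements conjugating \<open>g\<close> to
  \<open>c \<otimes> g\<close>. If also \<open>c \<otimes> c = \<one>\<close>, then together with
  C(g) they are the elements commuting with \<open>g\<close> modulo
  \<open>{\<one>, c}\<close>.\<close>

definition twisted_centralizer :: "('a, 'b) monoid_scheme \<Rightarrow> 'a \<Rightarrow> 'a \<Rightarrow> 'a set" where
  "twisted_centralizer G c g = {h \<in> carrier G. g \<otimes>\<^bsub>G\<^esub> h = c \<otimes>\<^bsub>G\<^esub> (h \<otimes>\<^bsub>G\<^esub> g)}"

locale central_involution = fin_group +
  fixes c
  assumes c_center: "c \<in> group_center G" and c_neq_one: "c \<noteq> \<one>" and c_square: "c \<otimes> c = \<one>"
begin

lemma c_closed [simp]: "c \<in> carrier G"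
  using c_center center_sub_carrier by blast

lemma c_left: "x \<in> carrier G \<Longrightarrow> y \<in> carrier G \<Longrightarrow> x \<otimes> (c \<otimes> y) = c \<otimes> (x \<otimes> y)"
  using center_commute[OF c_center, of x] m_assoc[of x c y] m_assoc[of c x y] by simp

lemma c_right: "x \<in> carrier G \<Longrightarrow> x \<otimes> c = c \<otimes> x"
  using center_commute[OF c_center, of x] by simp

lemma c_cancel: "x \<in> carrier G \<Longrightarrow> c \<otimes> (c \<otimes> x) = x"
  by (simp add: m_assoc[symmetric] c_square)

lemma c_mult_neq: "x \<in> carrier G \<Longrightarrow> c \<otimes> x \<noteq> x"
  using c_neq_one by simp

text \<open>Symmetry holds because \<open>c\<close> is its own inverse.\<close>

lemma twisted_commute: "g \<in> carrier G \<Longrightarrow> h \<in> twisted_centralizer G c g \<Longrightarrow> g \<in> twisted_centralizer G c h"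
  by (simp add: twisted_centralizer_def c_cancel)

text \<open>Where the commutator with \<open>g\<close> takes values in \<open>{\<one>, c}\<close>,
  it is multiplicative, since \<open>c\<close> is central. This lemma and the next are two cases of
  that.\<close>

lemma centralizer_twisted_mult:
  assumes "g \<in> carrier G" "k \<in> centralizer G g" "h \<in> twisted_centralizer G c g"
  shows "k \<otimes> h \<in> twisted_centralizer G c g"
proof -
  have carr: "k \<in> carrier G" "h \<in> carrier G" and gk: "g \<otimes> k = k \<otimes> g" and gh: "g \<otimes> h = c \<otimes> (h \<otimes> g)"
    using assms by (auto simp: centralizer_def twisted_centralizer_def)
  have "g \<otimes> (k \<otimes> h) = k \<otimes> (g \<otimes> h)"
    using assms(1) carr gk by (simp add: m_assoc[symmetric])
  also have "\<dots> = c \<otimes> (k \<otimes> h \<otimes> g)"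
    using assms(1) carr by (simp add: gh c_left m_assoc)
  finally show ?thesis
    using carr by (simp add: twisted_centralizer_def)
qed

lemma twisted_twisted_mult:
  assumes "g \<in> carrier G" "k \<in> twisted_centralizer G c g" "h \<in> twisted_centralizer G c g"
  shows "k \<otimes> h \<in> centralizer G g"
proof -
  have carr: "k \<in> carrier G" "h \<in> carrier G" and gk: "g \<otimes> k = c \<otimes> (k \<otimes> g)" and gh: "g \<otimes> h = c \<otimes> (h \<otimes> g)"
    using assms by (auto simp: twisted_centralizer_def)
  have "g \<otimes> (k \<otimes> h) = (c \<otimes> (k \<otimes> g)) \<otimes> h"
    using assms(1) carr gk by (simp add: m_assoc[symmetric])
  also have "\<dots> = c \<otimes> (k \<otimes> (g \<otimes> h))"
    using assms(1) carr by (simp add: m_assoc)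
  also have "\<dots> = k \<otimes> h \<otimes> g"
    using assms(1) carr by (simp add: gh c_left[of k] c_cancel m_assoc)
  finally show ?thesis
    using carr by (simp add: centralizer_def)
qed

text \<open>A nonempty twisted centralizer is a coset of C(g): right multiplication by one of its
  elements injects each set into the other.\<close>

lemma card_twisted_centralizer:
  assumes g: "g \<in> carrier G" and ne: "twisted_centralizer G c g \<noteq> {}"
  shows "card (twisted_centralizer G c g) = card (centralizer G g)"
proof -
  obtain h where h: "h \<in> twisted_centralizer G c g"
    using ne by blast
  have hc: "h \<in> carrier G"
    using h by (simp add: twisted_centralizer_def)
  have fin': "finite (twisted_centralizer G c g)" "finite (centralizer G g)"
    using fin by (auto simp: twisted_centralizer_def centralizer_def)
  have inj: "inj_on (\<lambda>k. k \<otimes> h) S" if "S \<subseteq> carrier G" for S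
    using that hc by (intro inj_onI) (simp add: subset_iff)
  have "card (centralizer G g) \<le> card (twisted_centralizer G c g)"
    by (rule card_inj_on_le[OF inj])
      (use centralizer_twisted_mult[OF g _ h] fin' centralizer_sub_carrier in auto)
  moreover have "card (twisted_centralizer G c g) \<le> card (centralizer G g)"
    by (rule card_inj_on_le[OF inj])
      (use twisted_twisted_mult[OF g _ h] fin' in \<open>auto simp: twisted_centralizer_def\<close>)
  ultimately show ?thesis
    by simp
qed

lemma sum_centralizers_split:
  "(\<Sum>g\<in>carrier G. card (centralizer G g)) = (\<Sum>g\<in>carrier G. card (twisted_centralizer G c g))
    + (\<Sum>g | g \<in> carrier G \<and> twisted_centralizer G c g = {}. card (centralizer G g))"
proof -
  have "(\<Sum>g | g \<in> carrier G \<and> twisted_centralizer G c g = {}. card (centralizer G g))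
      = (\<Sum>g\<in>carrier G. if twisted_centralizer G c g = {} then card (centralizer G g) else 0)"
    using fin by (simp add: sum.inter_filter)
  then show ?thesis
    by (simp add: sum.distrib[symmetric] card_twisted_centralizer cong: sum.cong)
      (intro sum.cong refl, simp add: card_twisted_centralizer)
qed

lemma sum_twisted_less:
  "(\<Sum>g\<in>carrier G. card (twisted_centralizer G c g)) < (\<Sum>g\<in>carrier G. card (centralizer G g))"
proof -
  \<comment> \<open>The identity supplies the strictness: for it the twisted condition reads
    \<open>h = c \<otimes> h\<close>.\<close>
  have "twisted_centralizer G c \<one> = {}"
    using c_mult_neq by (fastforce simp: twisted_centralizer_def)
  then have "card (centralizer G \<one>) \<le> (\<Sum>g | g \<in> carrier G \<and> twisted_centralizer G c g = {}. card (centralizer G g))"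
    using fin by (intro member_le_sum) auto
  then show ?thesis
    using card_subgroup_pos[OF centralizer_subgroup[of \<one>]] by (simp add: sum_centralizers_split)
qed

section \<open>The quotient by the subgroup of order two\<close>

definition quotient where "quotient = G Mod {\<one>, c}"

abbreviation proj where "proj g \<equiv> {\<one>, c} #> g"

lemma proj_eq: "g \<in> carrier G \<Longrightarrow> proj g = {g, c \<otimes> g}"
  by (auto simp: r_coset_def)

lemma proj_eq_iff:
  assumes "g \<in> carrier G" "h \<in> carrier G"
  shows "proj g = proj h \<longleftrightarrow> g = h \<or> g = c \<otimes> h"
  using assms by (auto simp: proj_eq doubleton_eq_iff c_cancel)

lemma N_subgroup: "subgroup {\<one>, c} G"
  by (rule subgroupI) (auto simp: c_square inv_equality)

lemma N_normal: "{\<one>, c} \<lhd> G"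
proof (rule normal_invI[OF N_subgroup])
  fix x h assume "x \<in> carrier G" "h \<in> {\<one>, c}"
  then show "x \<otimes> h \<otimes> inv x \<in> {\<one>, c}"
    by (auto simp: c_right m_assoc)
qed

lemma quotient_carrier: "carrier quotient = proj ` carrier G"
  by (simp add: quotient_def carrier_FactGroup)

lemma quotient_mult:
  assumes "g \<in> carrier G" "h \<in> carrier G"
  shows "proj g \<otimes>\<^bsub>quotient\<^esub> proj h = proj (g \<otimes> h)"
  using normal.rcos_sum[OF N_normal assms] by (simp add: quotient_def)

sublocale Q: fin_group quotient
  using normal.factorgroup_is_group[OF N_normal] fin
  by (simp add: fin_group_def fin_group_axioms_def quotient_carrier) (simp add: quotient_def)

lemma fibre:
  assumes "g \<in> carrier G"
  shows "{h \<in> carrier G. proj h = proj g} = {g, c \<otimes> g}"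
proof (rule Set.set_eqI)
  fix h
  show "h \<in> {h \<in> carrier G. proj h = proj g} \<longleftrightarrow> h \<in> {g, c \<otimes> g}"
    using assms by (cases "h \<in> carrier G") (auto simp: proj_eq_iff)
qed

lemma sum_quotient: "(\<Sum>g\<in>carrier G. f (proj g)) = 2 * (\<Sum>X\<in>carrier quotient. f X :: nat)"
proof -
  have "(\<Sum>g\<in>carrier G. f (proj g)) = (\<Sum>X\<in>proj ` carrier G. \<Sum>g | g \<in> carrier G \<and> proj g = X. f (proj g))"
    using sum.image_gen[OF fin] by blast
  also have "\<dots> = (\<Sum>X\<in>proj ` carrier G. 2 * f X)"
  proof (rule sum.cong)
    fix X assume "X \<in> proj ` carrier G"
    then obtain g where g: "g \<in> carrier G" "X = proj g"
      by blast
    then have "card {h \<in> carrier G. proj h = X} = 2"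
      using c_mult_neq[of g] by (simp add: fibre)
    then show "(\<Sum>g | g \<in> carrier G \<and> proj g = X. f (proj g)) = 2 * f X"
      by simp
  qed simp
  finally show ?thesis
    by (simp add: quotient_carrier sum_distrib_left)
qed

lemma order_quotient: "Coset.order G = 2 * Coset.order quotient"
  using sum_quotient[of "\<lambda>_. 1"] by (simp add: Coset.order_def)

lemma card_preimage:
  assumes "S \<subseteq> carrier quotient"
  shows "card {g \<in> carrier G. proj g \<in> S} = 2 * card S"
proof -
  have "(\<Sum>g\<in>carrier G. if proj g \<in> S then 1 else 0) = 2 * (\<Sum>X\<in>carrier quotient. if X \<in> S then 1 else 0 :: nat)"
    by (rule sum_quotient)
  moreover have "(\<Sum>g\<in>carrier G. if proj g \<in> S then 1 else 0) = card {g \<in> carrier G. proj g \<in> S}"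
    using fin by (simp add: sum.If_cases Collect_conj_eq)
  moreover have "(\<Sum>X\<in>carrier quotient. if X \<in> S then 1 else 0 :: nat) = card S"
    using assms Q.fin by (simp add: sum.If_cases Int_absorb1)
  ultimately show ?thesis
    by simp
qed

lemma quotient_commute_iff:
  assumes "g \<in> carrier G" "h \<in> carrier G"
  shows "proj g \<otimes>\<^bsub>quotient\<^esub> proj h = proj h \<otimes>\<^bsub>quotient\<^esub> proj g
    \<longleftrightarrow> h \<in> centralizer G g \<union> twisted_centralizer G c g"
  using assms by (simp add: quotient_mult proj_eq_iff centralizer_def twisted_centralizer_def)

text \<open>The preimage of the centralizer in the quotient is the disjoint union of the ordinary
  and the twisted centralizer, and \<open>proj\<close> is two-to-one.\<close>

lemma card_quotient_centralizer:
  assumes g: "g \<in> carrier G"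
  shows "2 * card (centralizer quotient (proj g)) = card (centralizer G g) + card (twisted_centralizer G c g)"
proof -
  have "{h \<in> carrier G. proj h \<in> centralizer quotient (proj g)} = centralizer G g \<union> twisted_centralizer G c g"
    using quotient_commute_iff[OF g]
    by (auto simp: centralizer_def[of quotient] quotient_carrier)
      (auto simp: centralizer_def twisted_centralizer_def)
  moreover have "centralizer G g \<inter> twisted_centralizer G c g = {}"
    using g c_mult_neq by (fastforce simp: centralizer_def twisted_centralizer_def)
  ultimately show ?thesis
    using card_preimage[OF Q.centralizer_sub_carrier, of "proj g"] fin
    by (simp add: card_Un_disjoint centralizer_def twisted_centralizer_def)
qed

lemma commuting_prob_quotient:
  "commuting_prob quotient * (real (Coset.order G))\<^sup>2
    = real ((\<Sum>g\<in>carrier G. card (centralizer G g)) + (\<Sum>g\<in>carrier G. card (twisted_centralizer G c g)))"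
proof -
  have "(\<Sum>g\<in>carrier G. card (centralizer G g)) + (\<Sum>g\<in>carrier G. card (twisted_centralizer G c g))
      = (\<Sum>g\<in>carrier G. 2 * card (centralizer quotient (proj g)))"
    by (simp add: sum.distrib[symmetric] card_quotient_centralizer)
  also have "\<dots> = 4 * (\<Sum>X\<in>carrier quotient. card (centralizer quotient X))"
    by (subst sum_distrib_left[symmetric], subst sum_quotient) simp
  finally show ?thesis
    using Q.sum_centralizers by (simp add: order_quotient)
qed

end

context central_involution begin

text \<open>The preimage \<open>K\<close> of the center of the quotient satisfies \<open>[g, h] \<in> {\<one>, c}\<close> for \<open>g \<in> K\<close>, hence
  squares of \<open>K\<close> are central in \<open>G\<close>, and a proper subgroup of \<open>K\<close> containing the center doubles in
  size when an element of \<open>K\<close> is adjoined.\<close>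

lemma center_index_quotient: obtains i where "center_index G = center_index quotient * 2 ^ i"
proof -
  let ?Z = "group_center G"
  define K where "K = {g \<in> carrier G. proj g \<in> group_center quotient}"
  have K_mult: "g \<otimes> h \<in> K" if "g \<in> K" "h \<in> K" for g h
    using that subgroup.m_closed[OF Q.center_subgroup, of "proj g" "proj h"]
    by (auto simp: K_def quotient_mult)
  have K_commute: "g \<otimes> h = h \<otimes> g \<or> g \<otimes> h = c \<otimes> (h \<otimes> g)" if "g \<in> K" "h \<in> carrier G" for g h
  proof -
    have "proj g \<otimes>\<^bsub>quotient\<^esub> proj h = proj h \<otimes>\<^bsub>quotient\<^esub> proj g"
      using that Q.center_commute[of "proj g" "proj h"] by (simp add: K_def quotient_carrier)
    then show ?thesis
      using that quotient_commute_iff[of g h] by (auto simp: K_def centralizer_def twisted_centralizer_def)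
  qed
  have K_square: "g \<otimes> g \<in> ?Z" if g: "g \<in> K" for g
  proof -
    have gc: "g \<in> carrier G"
      using g by (simp add: K_def)
    have "(g \<otimes> g) \<otimes> h = h \<otimes> (g \<otimes> g)" if h: "h \<in> carrier G" for h
    proof (cases "g \<otimes> h = h \<otimes> g")
      case True
      then show ?thesis
        using gc h by (metis m_assoc)
    next
      case False
      then have "h \<in> twisted_centralizer G c g"
        using K_commute[OF g h] h unfolding twisted_centralizer_def by blast
      then have "g \<in> twisted_centralizer G c h"
        by (rule twisted_commute[OF gc])
      \<comment> \<open>The two factors \<open>c\<close> cancel.\<close>
      then have "g \<otimes> g \<in> centralizer G h"
        using twisted_twisted_mult h by blast
      then show ?thesis
        by (simp add: centralizer_def)
    qed
    then show ?thesis
      using gc by (simp add: group_center_def)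
  qed
  \<comment> \<open>A maximal subgroup of this kind will turn out to be \<open>K\<close>, so that
    [K : Z(G)] is a power of two.\<close>
  define \<P> where "\<P> = {P. subgroup P G \<and> ?Z \<subseteq> P \<and> P \<subseteq> K \<and> (\<exists>i. card P = 2 ^ i * card ?Z)}"
  have "?Z \<subseteq> K"
  proof
    fix z assume z: "z \<in> ?Z"
    then have zc: "z \<in> carrier G"
      using center_sub_carrier by blast
    have "proj z \<otimes>\<^bsub>quotient\<^esub> X = X \<otimes>\<^bsub>quotient\<^esub> proj z" if "X \<in> carrier quotient" for X
      using that z zc center_commute[OF z]
      by (auto simp: quotient_carrier quotient_mult)
    then show "z \<in> K"
      using zc by (simp add: K_def group_center_def quotient_carrier)
  qed
  then have "?Z \<in> \<P>"
    using center_subgroup by (auto simp: \<P>_def intro: exI[of _ 0])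
  moreover have "\<P> \<subseteq> Pow (carrier G)"
    using subgroup.subset by (auto simp: \<P>_def)
  then have "finite \<P>"
    using fin finite_subset by blast
  ultimately obtain P where P: "P \<in> \<P>" and max: "\<And>P'. P' \<in> \<P> \<Longrightarrow> P \<subseteq> P' \<Longrightarrow> P = P'"
    using finite_has_maximal[of \<P>] by blast
  then obtain i where sub: "subgroup P G" and ZP: "?Z \<subseteq> P" and PK: "P \<subseteq> K" and i: "card P = 2 ^ i * card ?Z"
    by (auto simp: \<P>_def)
  have "P = K"
  proof (rule ccontr)
    assume "P \<noteq> K"
    then obtain g where g: "g \<in> K" "g \<notin> P"
      using PK by blast
    have gc: "g \<in> carrier G"
      using g by (simp add: K_def)
    have Pc: "p \<in> carrier G" if "p \<in> P" for p
      using subgroup.mem_carrier[OF sub that] .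
    note P_mult = subgroup.m_closed[OF sub] and P_inv = subgroup.m_inv_closed[OF sub]
    have cP: "c \<in> P"
      using ZP c_center by blast
    have ggP: "g \<otimes> g \<in> P"
      using K_square g ZP by blast
    \<comment> \<open>\<open>g\<close> normalizes \<open>P\<close>: commuting past \<open>p\<close>
      costs at most a factor \<open>c\<close>, which lies in the center and so in
      \<open>P\<close>.\<close>
    have swap: "\<exists>p'\<in>P. g \<otimes> p = p' \<otimes> g" if p: "p \<in> P" for p
      using K_commute[OF g(1) Pc[OF p]]
    proof
      assume "g \<otimes> p = c \<otimes> (p \<otimes> g)"
      then have "g \<otimes> p = (c \<otimes> p) \<otimes> g"
        using Pc[OF p] gc by (simp add: m_assoc)
      then show ?thesis
        using P_mult[OF cP p] by blast
    qed (use p in blast)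
    define P' where "P' = P \<union> (\<lambda>p. p \<otimes> g) ` P"
    have P'I: "p \<in> P'" "p \<otimes> g \<in> P'" if "p \<in> P" for p
      using that by (auto simp: P'_def)
    have "subgroup P' G"
    proof (rule subgroupI)
      show "P' \<subseteq> carrier G"
        using Pc gc by (auto simp: P'_def)
      show "P' \<noteq> {}"
        using cP by (auto simp: P'_def)
      show "inv a \<in> P'" if "a \<in> P'" for a
        using that unfolding P'_def
      proof
        assume "a \<in> (\<lambda>p. p \<otimes> g) ` P"
        then obtain p where p: "p \<in> P" "a = p \<otimes> g"
          by blast
        obtain p' where p': "p' \<in> P" "g \<otimes> inv p = p' \<otimes> g"
          using swap[OF P_inv[OF p(1)]] by blast
        have "inv a = inv (g \<otimes> g) \<otimes> (g \<otimes> inv p)"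
          using p Pc[OF p(1)] gc by (simp add: inv_mult_group m_assoc) (simp add: m_assoc[symmetric])
        also have "\<dots> = (inv (g \<otimes> g) \<otimes> p') \<otimes> g"
          using p' Pc gc by (simp add: m_assoc)
        finally show "inv a \<in> P \<union> (\<lambda>p. p \<otimes> g) ` P"
          using P_mult[OF P_inv[OF ggP] p'(1)] by blast
      qed (use P_inv in blast)
      show "a \<otimes> b \<in> P'" if a: "a \<in> P'" and b: "b \<in> P'" for a b
      proof -
        obtain p where p: "p \<in> P" "a = p \<or> a = p \<otimes> g"
          using a by (auto simp: P'_def)
        obtain q where q: "q \<in> P" "b = q \<or> b = q \<otimes> g"
          using b by (auto simp: P'_def)
        obtain q' where q': "q' \<in> P" "g \<otimes> q = q' \<otimes> g"
          using swap[OF q(1)] by blast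
        have c: "p \<in> carrier G" "q \<in> carrier G" "q' \<in> carrier G"
          using p q q' Pc by blast+
        have "(p \<otimes> g) \<otimes> q = p \<otimes> (g \<otimes> q)" "(p \<otimes> g) \<otimes> (q \<otimes> g) = p \<otimes> ((g \<otimes> q) \<otimes> g)"
          using c gc by (simp_all add: m_assoc)
        then have "(p \<otimes> g) \<otimes> q = (p \<otimes> q') \<otimes> g" "(p \<otimes> g) \<otimes> (q \<otimes> g) = (p \<otimes> q') \<otimes> (g \<otimes> g)"
          using c gc unfolding q'(2) by (simp_all add: m_assoc)
        moreover have "p \<otimes> (q \<otimes> g) = (p \<otimes> q) \<otimes> g"
          using c gc by (simp add: m_assoc)
        ultimately show ?thesis
          using p(2) q(2) P'I P_mult[OF p(1) q(1)] P_mult[OF p(1) q'(1)]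
            P_mult[OF P_mult[OF p(1) q'(1)] ggP] by auto
      qed
    qed
    moreover have "P' \<subseteq> K"
      using PK K_mult[OF _ g(1)] by (auto simp: P'_def)
    moreover have "card P' = 2 ^ Suc i * card ?Z"
    proof -
      have "P \<inter> (\<lambda>p. p \<otimes> g) ` P = {}"
        using mult_notin_subgroup(1)[OF sub _ gc g(2)] by blast
      moreover have "inj_on (\<lambda>p. p \<otimes> g) P"
        by (rule inj_onI) (simp add: Pc gc)
      ultimately have "card P' = card P + card P"
        using finite_subgroup[OF sub] by (simp add: P'_def card_Un_disjoint card_image)
      then show ?thesis
        by (simp add: i)
    qed
    ultimately have "P' \<in> \<P>"
      using ZP unfolding \<P>_def P'_def by blast
    then have "P = P'"
      using max by (auto simp: P'_def)
    then show False
      using g(2) P'I(2)[OF subgroup.one_closed[OF sub]] gc by simp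
  qed
  then have "2 * card (group_center quotient) = 2 ^ i * card ?Z"
    using card_preimage[OF Q.center_sub_carrier] i by (simp add: K_def)
  moreover have "center_index G * card ?Z = center_index quotient * (2 * card (group_center quotient))"
    using order_quotient Q.order_center_index order_center_index by (simp add: mult.left_commute)
  ultimately have "center_index G * card ?Z = (center_index quotient * 2 ^ i) * card ?Z"
    by (simp only: mult.assoc)
  then have "center_index G = center_index quotient * 2 ^ i"
    using card_center_pos by simp
  then show ?thesis
    by (rule that)
qed

end

context fin_group begin

text \<open>Here \<open>c\<close> is the commutator of \<open>x\<close> with any element outside \<open>A = C(x)\<close>. An element \<open>g\<close> that is
  not conjugate to \<open>cg\<close> lies in \<open>Z(G)\<close> or in \<open>A - Z(A)\<close>.\<close>

lemma central_involution_of_index_two_centralizer: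
  assumes x: "x \<in> carrier G - group_center G" and card: "Coset.order G = 2 * card (centralizer G x)"
    and center2: "card (group_center (G\<lparr>carrier := centralizer G x\<rparr>)) = 2 * card (group_center G)"
  obtains c where "central_involution G c"
    "4 * (\<Sum>g | g \<in> carrier G \<and> twisted_centralizer G c g = {}. card (centralizer G g)) \<le> (Coset.order G)\<^sup>2"
proof -
  define A where "A = centralizer G x"
  let ?Z = "group_center G" and ?GA = "G\<lparr>carrier := A\<rparr>"
  let ?ZA = "group_center ?GA"
  have xc: "x \<in> carrier G"
    using x by blast
  have A: "subgroup A G" and A_sub: "A \<subseteq> carrier G" and finA: "finite A"
    using x centralizer_subgroup subgroup.subset finite_subgroup unfolding A_def by blast+
  have cardA: "Coset.order G = 2 * card A"
    using card A_def by simp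
  interpret A: fin_group ?GA
    by (rule subgroup_fin_group[OF A])
  have ZA: "subgroup ?ZA G"
    using A.center_subgroup A incl_subgroup by blast
  have ZA_sub: "?ZA \<subseteq> A"
    using A.center_sub_carrier by simp
  have Z_sub: "?Z \<subseteq> ?ZA"
    using A_sub center_commute center_sub_centralizer[of x] x
    unfolding center_of_subgroup by (auto simp: A_def)
  have xZA: "x \<in> ?ZA - ?Z"
    using x centralizer_self unfolding center_of_subgroup by (auto simp: A_def centralizer_def)
  \<comment> \<open>By \<open>center2\<close>, Z(G) has index two in Z(A).\<close>
  have ZA_mult: "a \<otimes> b \<in> ?Z" if "a \<in> ?ZA - ?Z" "b \<in> ?ZA - ?Z" for a b
    using index_two_mult[OF center_subgroup ZA Z_sub _ that] center2 by (simp add: A_def)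
  have "card A < card (carrier G)"
    using cardA card_subgroup_pos[OF A] by (simp add: Coset.order_def)
  then obtain y where y: "y \<in> carrier G" "y \<notin> A"
    using card_mono[OF finA, of "carrier G"] by (meson not_less subsetI)
  \<comment> \<open>The conjugacy class of \<open>x\<close> is the pair of \<open>x\<close> and
    \<open>x'\<close>, as C(x) has index two; \<open>c\<close> is chosen so that
    \<open>x' = x \<otimes> c\<close>.\<close>
  define x' where "x' = y \<otimes> x \<otimes> inv y"
  define c where "c = inv x \<otimes> x'"
  have x'c: "x' \<in> carrier G"
    using xc y by (simp add: x'_def)
  have yx: "y \<otimes> x = x' \<otimes> y"
    using xc y by (simp add: x'_def m_assoc)
  have x'_eq: "x' = x \<otimes> c"
    using xc x'c by (simp add: c_def m_assoc[symmetric])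
  \<comment> \<open>\<open>A\<close> is normal, so commutation of \<open>x'\<close> with
    \<open>a\<close> reduces to that of \<open>x\<close> with a conjugate of
    \<open>a\<close>.\<close>
  have "x' \<in> ?ZA"
    unfolding center_of_subgroup
  proof (intro CollectI conjI ballI)
    show "x' \<in> A"
      using index_two_conj[OF A cardA y(1)] xZA ZA_sub by (auto simp: x'_def)
    fix a assume a: "a \<in> A"
    have ac: "a \<in> carrier G"
      using a A_sub by blast
    have "inv y \<otimes> a \<otimes> y \<in> A"
      using index_two_conj[OF A cardA _ a, of "inv y"] y by simp
    then have "x \<otimes> (inv y \<otimes> a \<otimes> y) = (inv y \<otimes> a \<otimes> y) \<otimes> x"
      by (simp add: A_def centralizer_def)
    then have "y \<otimes> (x \<otimes> (inv y \<otimes> a \<otimes> y)) \<otimes> inv y = y \<otimes> ((inv y \<otimes> a \<otimes> y) \<otimes> x) \<otimes> inv y"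
      by simp
    then show "x' \<otimes> a = a \<otimes> x'"
      using xc y ac by (simp add: x'_def m_assoc) (simp add: m_assoc[symmetric])
  qed
  moreover have "x' \<notin> ?Z"
  proof
    assume "x' \<in> ?Z"
    then have "x' \<otimes> y = y \<otimes> x'"
      using y center_commute by blast
    then have "x = x'"
      using yx y xc x'c by simp
    then show False
      using \<open>x' \<in> ?Z\<close> x by simp
  qed
  ultimately have x'ZA: "x' \<in> ?ZA - ?Z"
    by blast
  have "inv x \<in> ?ZA - ?Z"
    using xZA xc subgroup.m_inv_closed[OF ZA] subgroup.m_inv_closed[OF center_subgroup, of "inv x"] by auto
  then have c_center: "c \<in> ?Z"
    using ZA_mult x'ZA by (simp add: c_def)
  then have cc: "c \<in> carrier G"
    using center_sub_carrier by blast
  have "c \<noteq> \<one>"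
  proof
    assume "c = \<one>"
    then have "y \<in> A"
      using yx y xc x'_eq by (simp add: A_def centralizer_def)
    then show False
      using y by simp
  qed
  \<comment> \<open>The square of \<open>x\<close> is central, so conjugation by \<open>y\<close>
    fixes it, and it equals \<open>x' \<otimes> x'\<close>.\<close>
  moreover have "c \<otimes> c = \<one>"
  proof -
    have "x \<otimes> x \<in> ?Z"
      using ZA_mult xZA by blast
    then have "(x \<otimes> x) \<otimes> y = y \<otimes> (x \<otimes> x)"
      using center_commute y by blast
    also have "\<dots> = (x' \<otimes> y) \<otimes> x"
      using y xc x'c yx by (simp add: m_assoc[symmetric])
    also have "\<dots> = x' \<otimes> (y \<otimes> x)"
      using y xc x'c by (simp add: m_assoc)
    also have "\<dots> = (x' \<otimes> x') \<otimes> y"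
      using y xc x'c yx by (simp add: m_assoc)
    finally have "x \<otimes> x = x' \<otimes> x'"
      using y xc x'c by simp
    also have "\<dots> = (x \<otimes> x) \<otimes> (c \<otimes> c)"
      using xc cc center_commute[OF c_center] unfolding x'_eq by (metis m_assoc m_closed)
    finally show ?thesis
      using xc cc by simp
  qed
  ultimately have inv: "central_involution G c"
    using c_center fin_group_axioms by (simp add: central_involution_def central_involution_axioms_def)
  interpret central_involution G c
    by (rule inv)
  have y_twisted: "y \<in> twisted_centralizer G c x"
    using y yx xc by (simp add: twisted_centralizer_def x'_eq c_right c_cancel m_assoc)
  let ?E = "{g \<in> carrier G. twisted_centralizer G c g = {}}"
  \<comment> \<open>The elements outside C(x) form the coset of \<open>y\<close>, so all of them
    conjugate \<open>x\<close> to \<open>c \<otimes> x\<close>; symmetry then exchanges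
    \<open>g\<close> and \<open>x\<close>.\<close>
  have outside: "twisted_centralizer G c g \<noteq> {}" if g: "g \<in> carrier G" "g \<notin> A" for g
  proof -
    have "inv y \<notin> A"
      using y subgroup.m_inv_closed[OF A, of "inv y"] by auto
    then have "g \<otimes> inv y \<in> A"
      using index_two_mult[OF A subgroup_carrier A_sub, of g "inv y"] cardA g y by (simp add: Coset.order_def)
    then have "(g \<otimes> inv y) \<otimes> y \<in> twisted_centralizer G c x"
      using centralizer_twisted_mult[OF xc _ y_twisted] by (simp add: A_def)
    then have "g \<in> twisted_centralizer G c x"
      using g y by (simp add: m_assoc)
    then show ?thesis
      using twisted_commute xc by blast
  qed
  \<comment> \<open>Such a \<open>g\<close> is a central multiple of \<open>x\<close>, so
    \<open>y\<close> conjugates it by the same twist.\<close>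
  have inside: "twisted_centralizer G c g \<noteq> {}" if g: "g \<in> ?ZA - ?Z" for g
  proof -
    have gc: "g \<in> carrier G"
      using g ZA_sub A_sub by blast
    have "inv x \<in> ?ZA - ?Z"
      by fact
    then have "g \<otimes> inv x \<in> ?Z"
      using ZA_mult g by blast
    then have "g \<otimes> inv x \<in> centralizer G y"
      using center_sub_centralizer y by blast
    then have "(g \<otimes> inv x) \<otimes> x \<in> twisted_centralizer G c y"
      using centralizer_twisted_mult[OF y(1)] twisted_commute[OF xc y_twisted] by blast
    then have "g \<in> twisted_centralizer G c y"
      using gc xc by (simp add: m_assoc)
    then show ?thesis
      using twisted_commute y by blast
  qed
  have E_sub: "?E \<subseteq> ?Z \<union> (A - ?ZA)"
    using outside inside by blast
  have finZ: "finite ?Z"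
    using center_subgroup finite_subgroup by blast
  have "2 * (\<Sum>g\<in>?E. card (centralizer G g)) \<le> 2 * (\<Sum>g\<in>?Z \<union> (A - ?ZA). card (centralizer G g))"
    using E_sub finA finZ by (simp add: sum_mono2)
  also have "\<dots> = 2 * (\<Sum>g\<in>?Z. card (centralizer G g)) + (\<Sum>g\<in>A - ?ZA. 2 * card (centralizer G g))"
    using finA finZ Z_sub by (subst sum.union_disjoint) (auto simp: sum_distrib_left)
  also have "\<dots> \<le> 2 * (card ?Z * Coset.order G) + (card A - card ?ZA) * Coset.order G"
  proof (intro add_mono)
    show "2 * (\<Sum>g\<in>?Z. card (centralizer G g)) \<le> 2 * (card ?Z * Coset.order G)"
      by (simp add: card_centralizer_central)
    have "(\<Sum>g\<in>A - ?ZA. 2 * card (centralizer G g)) \<le> (\<Sum>g\<in>A - ?ZA. Coset.order G)"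
    proof (rule sum_mono)
      fix g assume "g \<in> A - ?ZA"
      then have "g \<in> carrier G - ?Z"
        using A_sub Z_sub by blast
      then obtain j l where j: "2 \<le> j" "2 \<le> l" "Coset.order G = j * card (centralizer G g)"
        "card (centralizer G g) = l * card (group_center G)" "center_index G = j * l"
        by (rule noncentral_centralizer)
      then show "2 * card (centralizer G g) \<le> Coset.order G"
        using mult_le_mono1[OF j(1), of "card (centralizer G g)"] by simp
    qed
    also have "\<dots> = (card A - card ?ZA) * Coset.order G"
      using finA ZA_sub by (simp add: card_Diff_subset finite_subset)
    finally show "(\<Sum>g\<in>A - ?ZA. 2 * card (centralizer G g)) \<le> (card A - card ?ZA) * Coset.order G" .
  qed
  \<comment> \<open>Z(A) is twice as large as Z(G), so removing it from \<open>A\<close> exactly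
    pays for the central terms, which count double.\<close>
  also have "\<dots> = card A * Coset.order G"
  proof -
    have "card ?ZA \<le> card A"
      using finA ZA_sub card_mono by blast
    then obtain d where d: "card A = card ?ZA + d"
      using le_Suc_ex by blast
    have "card ?ZA = 2 * card ?Z"
      using center2 by (simp add: A_def)
    then show ?thesis
      unfolding d by (simp add: algebra_simps)
  qed
  finally have "4 * (\<Sum>g\<in>?E. card (centralizer G g)) \<le> 2 * (card A * Coset.order G)"
    by linarith
  moreover have "2 * (card A * Coset.order G) = (Coset.order G)\<^sup>2"
    by (simp add: power2_eq_square cardA)
  ultimately have "4 * (\<Sum>g\<in>?E. card (centralizer G g)) \<le> (Coset.order G)\<^sup>2"
    by simp
  then show ?thesis
    by (rule that[OF inv])
qed

end

section \<open>Large commuting probabilities\<close>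

context fin_group begin

text \<open>With N commuting pairs, T twisted pairs and remainder E, N = T + E and Pr(G/N') |G|^2 =
  N + T for the subgroup N' of order two. Hence N = (N + T)/2 + E/2, where E is at most |G|^2/4;
  strictness comes from T < N.\<close>

lemma quotient_of_index_two_centralizer:
  assumes "x \<in> carrier G - group_center G" "Coset.order G = 2 * card (centralizer G x)"
    and "card (group_center (G\<lparr>carrier := centralizer G x\<rparr>)) = 2 * card (group_center G)"
  obtains H :: "'a set monoid" and i where "fin_group H" "commuting_prob G \<le> commuting_prob H / 2 + 1 / 8"
    "commuting_prob H / 2 < commuting_prob G" "center_index G = center_index H * 2 ^ i"
proof -
  obtain c where c: "central_involution G c"
    and le: "4 * (\<Sum>g | g \<in> carrier G \<and> twisted_centralizer G c g = {}. card (centralizer G g)) \<le> (Coset.order G)\<^sup>2"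
    using central_involution_of_index_two_centralizer[OF assms] by blast
  interpret central_involution G c
    by (rule c)
  define N where "N = (\<Sum>g\<in>carrier G. card (centralizer G g))"
  define T where "T = (\<Sum>g\<in>carrier G. card (twisted_centralizer G c g))"
  define E where "E = (\<Sum>g | g \<in> carrier G \<and> twisted_centralizer G c g = {}. card (centralizer G g))"
  let ?g2 = "(real (Coset.order G))\<^sup>2"
  have g2: "0 < ?g2"
    using order_pos by simp
  have N: "real N = commuting_prob G * ?g2"
    unfolding N_def by (rule sum_centralizers)
  have NT: "commuting_prob quotient * ?g2 = real N + real T"
    using commuting_prob_quotient by (simp add: N_def T_def)
  have "real N = real T + real E"
    using sum_centralizers_split by (simp add: N_def T_def E_def)
  moreover have "real (4 * E) \<le> real ((Coset.order G)\<^sup>2)"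
    using le unfolding E_def by (simp only: of_nat_le_iff)
  then have "4 * real E \<le> ?g2"
    by simp
  moreover have "n \<le> (n + t) / 2 + g / 8" if "n = t + e" "4 * e \<le> g" for n t e g :: real
    using that by (simp add: field_simps)
  ultimately have "real N \<le> (real N + real T) / 2 + ?g2 / 8"
    by blast
  then have "commuting_prob G * ?g2 \<le> (commuting_prob quotient / 2 + 1 / 8) * ?g2"
    using N NT by (simp add: distrib_right)
  then have le': "commuting_prob G \<le> commuting_prob quotient / 2 + 1 / 8"
    using g2 by simp
  have "real T < real N"
    using sum_twisted_less unfolding N_def T_def by (simp only: of_nat_less_iff)
  then have "(commuting_prob quotient / 2) * ?g2 < commuting_prob G * ?g2"
    using N NT by simp
  then have less: "commuting_prob quotient / 2 < commuting_prob G"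
    using g2 by simp
  obtain i where "center_index G = center_index quotient * 2 ^ i"
    by (rule center_index_quotient)
  then show ?thesis
    by (rule that[OF Q.fin_group_axioms le' less])
qed

text \<open>The number 24 is a common multiple of the indices that can occur: 1, 2, 3, 4, 6 without
  a centralizer of index two, and 2r with r = 3 or 4 if such a centralizer is abelian. The threshold
  is 3/7 = 4 (5/14 - 1/4), the bound on Pr(A) obtained from Pr(G) = 5/14 and r = 3.\<close>

lemma center_index_dvd_or_quotient:
  assumes p: "3 / 7 \<le> commuting_prob G"
  obtains "center_index G dvd 24"
  | (quotient) H :: "'a set monoid" and i where "fin_group H" "commuting_prob G \<le> commuting_prob H / 2 + 1 / 8"
    "center_index G = center_index H * 2 ^ i"
proof (cases "\<exists>x\<in>carrier G - group_center G. Coset.order G = 2 * card (centralizer G x)")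
  case False
  then have "commuting_prob G \<le> 1 / 3 + 2 / (3 * center_index G)"
    using commuting_prob_le_third by blast
  with p have "2 / 21 \<le> 2 / (3 * real (center_index G))"
    by simp
  \<comment> \<open>Equality 1/3 + 2/(3n) = 3/7 occurs at n = 7; the primes 5 and 7 must then be
    ruled out, as they do not divide 24.\<close>
  then have "center_index G \<le> 7"
    using center_index_pos by (simp add: field_simps)
  moreover have "prime (5::nat)" "prime (7::nat)"
    by simp_all
  then have "center_index G \<noteq> 5" "center_index G \<noteq> 7"
    using center_index_not_prime by auto
  ultimately have "center_index G \<in> {1, 2, 3, 4, 6}"
    using center_index_pos by auto
  then show ?thesis
    using that(1) by auto
next
  case True
  then obtain x where x: "x \<in> carrier G - group_center G" "Coset.order G = 2 * card (centralizer G x)"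
    by blast
  let ?A = "G\<lparr>carrier := centralizer G x\<rparr>"
  interpret A: fin_group ?A
    using subgroup_fin_group centralizer_subgroup x(1) by blast
  obtain r where r: "2 \<le> r" "card (group_center ?A) = r * card (group_center G)"
    "center_index G = 2 * r * center_index ?A" "commuting_prob G \<le> commuting_prob ?A / 4 + 3 / (4 * real r)"
    using index_two_centralizer[OF x] .
  show ?thesis
  proof (cases "r = 2")
    case True
    then show ?thesis
      using quotient_of_index_two_centralizer[OF x] r(2) that(2) by metis
  next
    case False
    with r(1) have r3: "3 \<le> r"
      by simp
    then have quarter: "3 / (4 * real r) \<le> 1 / 4"
      by (simp add: field_simps)
    have ab: "comm_group ?A"
    proof (rule ccontr)
      assume "\<not> comm_group ?A"
      then show False
        using A.commuting_prob_le_5_8 quarter r(4) p by simp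
    qed
    then have "3 / 7 \<le> 1 / 4 + 3 / (4 * real r)"
      using A.abelian_commuting_prob r(4) p by simp
    then have "r \<le> 4"
      using r3 by (simp add: field_simps)
    then have "r = 3 \<or> r = 4"
      using r3 by auto
    then have "center_index G dvd 24"
      using r(3) A.abelian_center_index[OF ab] by auto
    then show ?thesis
      by (rule that(1))
  qed
qed

text \<open>The threshold is 7/16 = (5/8)/2 + 1/8, so above it the quotient is abelian and the index
  of the center is a power of two in that case.\<close>

lemma center_index_dvd_aux:
  assumes p: "7 / 16 < commuting_prob G"
  shows "\<exists>k. center_index G dvd 3 * 2 ^ k"
proof -
  have "3 / 7 \<le> commuting_prob G"
    using p by simp
  then show ?thesis
  proof (cases rule: center_index_dvd_or_quotient)
    case 1
    then show ?thesis
      by (intro exI[of _ 3]) simp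
  next
    case (quotient H i)
    interpret H: fin_group H
      by fact
    have "comm_group H"
      using H.commuting_prob_le_5_8 quotient(2) p by force
    then have "center_index G dvd 3 * 2 ^ i"
      using quotient(3) H.abelian_center_index by simp
    then show ?thesis ..
  qed
qed

end

text \<open>A quotient \<open>H\<close> has commuting probability at least 2 (3/7 - 1/8) = 17/28 >
  7/16, so the descent ends after one further quotient.\<close>

lemma (in fin_group) center_index_dvd:
  assumes p: "3 / 7 \<le> commuting_prob G"
  shows "\<exists>k. center_index G dvd 3 * 2 ^ k"
  using p
proof (cases rule: center_index_dvd_or_quotient)
  case 1
  then show ?thesis
    by (intro exI[of _ 3]) simp
next
  case (quotient H i)
  have "7 / 16 < commuting_prob H"
    using quotient(2) p by simp
  then obtain k where "center_index H dvd 3 * 2 ^ k"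
    using fin_group.center_index_dvd_aux[OF quotient(1)] by blast
  then have "center_index G dvd 3 * 2 ^ (k + i)"
    unfolding quotient(3) power_add mult.assoc[symmetric] by (rule mult_dvd_mono) simp
  then show ?thesis ..
qed

lemma odd_prime_powers_not_dvd:
  "\<not> 7 dvd (9 * 2 ^ k :: nat)" "\<not> 5 dvd (9 * 2 ^ k :: nat)" "\<not> 9 dvd (3 * 2 ^ k :: nat)"
proof -
  have pow: "\<not> q dvd 2 ^ k" if "prime q" "q \<noteq> 2" for q :: nat
    using that prime_dvd_power primes_dvd_imp_eq two_is_prime_nat by blast
  show "\<not> 7 dvd (9 * 2 ^ k :: nat)"
    using pow[of 7] prime_dvd_mult_iff[of "7::nat" 9 "2 ^ k"] by auto
  show "\<not> 5 dvd (9 * 2 ^ k :: nat)"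
    using pow[of 5] prime_dvd_mult_iff[of "5::nat" 9 "2 ^ k"] by auto
  show "\<not> 9 dvd (3 * 2 ^ k :: nat)"
    using pow[of 3] dvd_mult_cancel_left[of 3 3 "2 ^ k :: nat"] by simp
qed

section \<open>Excluding nonabelian centralizers of noncentral elements\<close>

context fin_group begin

text \<open>The factors are the indices in Z(G) < Z(C(x)) < C(x) < G; the first inclusion is strict
  because of \<open>x\<close>, and the middle index is at least 4 for a nonabelian C(x).\<close>

lemma nonabelian_centralizer_index:
  assumes x: "x \<in> carrier G - group_center G" and C: "\<not> comm_group (G\<lparr>carrier := centralizer G x\<rparr>)"
  obtains j k l where "2 \<le> j" "4 \<le> k" "2 \<le> l" "Coset.order G = j * card (centralizer G x)" "center_index G = j * k * l"
proof -
  let ?C = "G\<lparr>carrier := centralizer G x\<rparr>"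
  have sub: "subgroup (centralizer G x) G"
    using x centralizer_subgroup by blast
  interpret C: fin_group ?C
    by (rule subgroup_fin_group[OF sub])
  have ZC: "subgroup (group_center ?C) G"
    using C.center_subgroup sub incl_subgroup by blast
  have "group_center G \<subset> group_center ?C"
  proof
    show "group_center G \<subseteq> group_center ?C"
      using center_commute center_sub_centralizer[of x] centralizer_sub_carrier[of x] x
      unfolding center_of_subgroup by blast
    have "x \<in> group_center ?C"
      using x centralizer_self unfolding center_of_subgroup by (auto simp: centralizer_def)
    then show "group_center G \<noteq> group_center ?C"
      using x by blast
  qed
  then obtain l where l: "2 \<le> l" "card (group_center ?C) = l * card (group_center G)"
    using card_proper_subgroup[OF center_subgroup ZC] by metis
  obtain j l' where j: "2 \<le> j" "2 \<le> l'" "Coset.order G = j * card (centralizer G x)"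
    "card (centralizer G x) = l' * card (group_center G)" "center_index G = j * l'"
    using x by (rule noncentral_centralizer)
  have "card (centralizer G x) = center_index ?C * (l * card (group_center G))"
    using C.order_center_index l(2) by (simp add: Coset.order_def)
  then have "l' = center_index ?C * l"
    using j(4) card_center_pos by simp
  then have "center_index G = j * center_index ?C * l"
    using j(5) by simp
  then show ?thesis
    by (rule that[OF j(1) C.nonabelian_center_index_ge[OF C] l(1) j(3)])
qed

lemma center_index_divisors:
  shows "commuting_prob G = 5 / 14 \<Longrightarrow> 14 dvd center_index G"
    and "commuting_prob G = 2 / 5 \<Longrightarrow> 5 dvd center_index G"
    and "commuting_prob G = 11 / 27 \<Longrightarrow> 9 dvd center_index G"
proof -
  obtain m where m: "commuting_prob G * (real (center_index G))\<^sup>2 = real m"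
    by (rule commuting_prob_center_index)
  let ?n = "center_index G"
  show "14 dvd ?n" if "commuting_prob G = 5 / 14"
  proof -
    have "real (5 * ?n\<^sup>2) = real (14 * m)"
      using m that by simp
    then have eq: "5 * ?n\<^sup>2 = 14 * m"
      by (simp only: of_nat_eq_iff)
    have "2 dvd 5 * ?n\<^sup>2" "7 dvd 5 * ?n\<^sup>2"
      unfolding eq by simp_all
    then have "2 dvd ?n" "7 dvd ?n"
      by (auto simp: prime_dvd_mult_iff prime_dvd_power_iff)
    then show ?thesis
      by presburger
  qed
  show "5 dvd ?n" if "commuting_prob G = 2 / 5"
  proof -
    have "real (2 * ?n\<^sup>2) = real (5 * m)"
      using m that by simp
    then have eq: "2 * ?n\<^sup>2 = 5 * m"
      by (simp only: of_nat_eq_iff)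
    have "5 dvd 2 * ?n\<^sup>2"
      unfolding eq by simp
    then show ?thesis
      by (auto simp: prime_dvd_mult_iff prime_dvd_power_iff)
  qed
  show "9 dvd ?n" if "commuting_prob G = 11 / 27"
  proof -
    have "real (11 * ?n\<^sup>2) = real (27 * m)"
      using m that by simp
    then have eq: "11 * ?n\<^sup>2 = 27 * m"
      by (simp only: of_nat_eq_iff)
    have "3 dvd 11 * ?n\<^sup>2"
      unfolding eq by simp
    then have "3 dvd ?n"
      by (auto simp: prime_dvd_mult_iff prime_dvd_power_iff)
    then obtain a where a: "?n = 3 * a"
      by blast
    \<comment> \<open>Since 27 has one factor 3 more than the square of 3, a second factor 3 of the
      index survives cancellation.\<close>
    then have "3 dvd 11 * a\<^sup>2"
      using eq by (simp add: power_mult_distrib)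
    then have "3 dvd a"
      by (auto simp: prime_dvd_mult_iff prime_dvd_power_iff)
    then show ?thesis
      using a by auto
  qed
qed

lemma comm_group_subgroup_iff:
  assumes "subgroup S G"
  shows "comm_group (G\<lparr>carrier := S\<rparr>) \<longleftrightarrow> (\<forall>a\<in>S. \<forall>b\<in>S. a \<otimes> b = b \<otimes> a)"
proof
  assume "comm_group (G\<lparr>carrier := S\<rparr>)"
  then show "\<forall>a\<in>S. \<forall>b\<in>S. a \<otimes> b = b \<otimes> a"
    using comm_monoid.m_comm by (fastforce simp: comm_group_def)
next
  assume "\<forall>a\<in>S. \<forall>b\<in>S. a \<otimes> b = b \<otimes> a"
  then show "comm_group (G\<lparr>carrier := S\<rparr>)"
    by (intro group.group_comm_groupI subgroup_imp_group assms) simp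
qed

text \<open>If \<open>w\<close> is in \<open>A\<close>, then C(w) lies in \<open>A\<close>, since an
  outside element commuting with \<open>w\<close> would make \<open>w\<close> central. Otherwise
  C(w) \<inter> A is central, so C(w) consists of Z(G) and its coset of \<open>w\<close>.\<close>

lemma centralizer_commute_if_abelian_index_two:
  assumes A: "subgroup A G" and card: "Coset.order G = 2 * card A"
    and ab: "\<And>a b. a \<in> A \<Longrightarrow> b \<in> A \<Longrightarrow> a \<otimes> b = b \<otimes> a"
    and w: "w \<in> carrier G - group_center G" and uv: "u \<in> centralizer G w" "v \<in> centralizer G w"
  shows "u \<otimes> v = v \<otimes> u"
proof -
  have wc: "w \<in> carrier G" and C: "subgroup (centralizer G w) G"
    using w centralizer_subgroup by blast+
  show ?thesis
  proof (cases "w \<in> A")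
    case True
    have "h \<in> A" if "h \<in> centralizer G w" for h
      using that index_two_central[OF A card, of h w] ab[OF True] w by (auto simp: centralizer_def)
    then show ?thesis
      using ab uv by blast
  next
    case False
    have central: "h \<in> group_center G" if "h \<in> centralizer G w" "h \<in> A" for h
      using that index_two_central[OF A card, of w h] False ab[OF that(2)] wc by (auto simp: centralizer_def)
    have decomp: "\<exists>z\<in>group_center G. h = z \<or> h = z \<otimes> w" if h: "h \<in> centralizer G w" for h
    proof (cases "h \<in> A")
      case True
      then show ?thesis
        using central h by blast
    next
      case hA: False
      have hc: "h \<in> carrier G"
        using h centralizer_sub_carrier by blast
      have "inv w \<notin> A"
        using False wc subgroup.m_inv_closed[OF A, of "inv w"] by auto
      then have "h \<otimes> inv w \<in> A"
        using index_two_mult[OF A subgroup_carrier subgroup.subset[OF A], of h "inv w"] card hA hc wc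
        by (simp add: Coset.order_def)
      moreover have "h \<otimes> inv w \<in> centralizer G w"
        using subgroup.m_closed[OF C h subgroup.m_inv_closed[OF C centralizer_self[OF wc]]] .
      moreover have "h = (h \<otimes> inv w) \<otimes> w"
        using hc wc by (simp add: m_assoc)
      ultimately show ?thesis
        using central by blast
    qed
    obtain z where z: "z \<in> group_center G" "v = z \<or> v = z \<otimes> w"
      using decomp uv(2) by blast
    have uc: "u \<in> carrier G" and uw: "u \<otimes> w = w \<otimes> u"
      using uv(1) by (auto simp: centralizer_def)
    have zc: "z \<in> carrier G" and uz: "u \<otimes> z = z \<otimes> u"
      using z(1) center_sub_carrier center_commute uc by (blast, metis)
    show ?thesis
      using z(2) uz commute_mult[OF uc zc wc uz uw] by blast
  qed
qed

lemma centralizer_abelian: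
  assumes p: "commuting_prob G \<in> {5/14, 2/5, 11/27, 1/2, 5/8}" and w: "w \<in> carrier G - group_center G"
  shows "comm_group (G\<lparr>carrier := centralizer G w\<rparr>)"
proof (rule ccontr)
  assume nonab: "\<not> comm_group (G\<lparr>carrier := centralizer G w\<rparr>)"
  let ?n = "center_index G"
  obtain j k l where jkl: "2 \<le> j" "4 \<le> k" "2 \<le> l" "Coset.order G = j * card (centralizer G w)" "?n = j * k * l"
    using nonabelian_centralizer_index[OF w nonab] .
  have "2 * 4 * 2 \<le> ?n"
    unfolding jkl(5) by (intro mult_le_mono jkl(1-3))
  then have "1 / (2 * real ?n) \<le> 1 / 32"
    by (simp add: field_simps)
  then have no58: "commuting_prob G \<in> {5/14, 2/5, 11/27, 1/2}"
    using p commuting_prob_le_half by auto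
  \<comment> \<open>The factor 9 rather than 3 leaves room for the case r = 3, where the index of
    the center gains another factor 3.\<close>
  have five_or_seven: False if "commuting_prob G = 5 / 14 \<or> commuting_prob G = 2 / 5" "?n dvd 9 * 2 ^ i" for i
    using that(1)
  proof
    assume "commuting_prob G = 5 / 14"
    then have "14 dvd ?n"
      by (rule center_index_divisors(1))
    then have "7 dvd ?n"
      using dvd_trans[of 7 14 ?n] by simp
    then have "7 dvd (9 * 2 ^ i :: nat)"
      using that(2) by (rule dvd_trans)
    then show False
      using odd_prime_powers_not_dvd(1) by contradiction
  next
    assume "commuting_prob G = 2 / 5"
    then have "5 dvd ?n"
      by (rule center_index_divisors(2))
    then have "5 dvd (9 * 2 ^ i :: nat)"
      using that(2) by (rule dvd_trans)
    then show False
      using odd_prime_powers_not_dvd(2) by contradiction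
  qed
  have no_quotient: False if "commuting_prob G \<noteq> 1/2" "?n dvd 3 * 2 ^ i" for i
  proof -
    have nine: "?n dvd 9 * 2 ^ i"
      by (rule dvd_trans[OF that(2)]) (simp add: mult_dvd_mono)
    from no58 that(1) consider "commuting_prob G = 5 / 14" | "commuting_prob G = 2 / 5" | "commuting_prob G = 11 / 27"
      by blast
    then show False
    proof cases
      case 1
      then show False
        using five_or_seven nine by blast
    next
      case 2
      then show False
        using five_or_seven nine by blast
    next
      case 3
      then have "9 dvd ?n"
        by (rule center_index_divisors(3))
      then have "9 dvd (3 * 2 ^ i :: nat)"
        using that(2) by (rule dvd_trans)
      then show False
        using odd_prime_powers_not_dvd(3) by contradiction
    qed
  qed
  show False
  proof (cases "\<exists>x\<in>carrier G - group_center G. Coset.order G = 2 * card (centralizer G x)")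
    case False
    then have le: "commuting_prob G \<le> 1 / 3 + 2 / (3 * ?n)"
      using commuting_prob_le_third by blast
    have "j \<noteq> 2"
      using False w jkl(4) by blast
    then have j3: "3 \<le> j"
      using jkl(1) by simp
    have "3 * 4 * 2 \<le> ?n"
      unfolding jkl(5) by (intro mult_le_mono jkl j3)
    then have n24: "24 \<le> ?n"
      by simp
    then have "2 / (3 * real ?n) \<le> 1 / 36"
      by (simp add: field_simps)
    \<comment> \<open>The bound 1/3 + 1/36 = 13/36 lies below 2/5.\<close>
    then have p: "commuting_prob G = 5 / 14"
      using le no58 by auto
    then have "1 / 42 \<le> 2 / (3 * real ?n)"
      using le by simp
    then have "?n \<le> 28"
      using center_index_pos by (simp add: field_simps)
    moreover have "14 dvd ?n"
      using center_index_divisors p by blast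
    ultimately have n28: "?n = 28"
      using n24 by presburger
    \<comment> \<open>28 is not a product \<open>j * k * l\<close> with \<open>j\<close> at least 3,
      \<open>k\<close> at least 4 and \<open>l\<close> at least 2.\<close>
    show False
    proof (cases "l = 2")
      case True
      then have jk: "j * k = 14"
        using n28 jkl(5) by simp
      then have "j dvd 14"
        by (metis dvd_triv_left)
      have "j \<le> 3"
      proof (rule ccontr)
        assume "\<not> j \<le> 3"
        then have "4 * 4 \<le> j * k"
          using jkl(2) by (intro mult_le_mono) auto
        then show False
          using jk by simp
      qed
      then show False
        using j3 \<open>j dvd 14\<close> by (cases "j = 3") auto
    next
      case False
      then have "3 * 4 * 3 \<le> j * k * l"
        using jkl j3 by (intro mult_le_mono) auto
      then show False
        using n28 jkl(5) by simp
    qed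
  next
    case True
    then obtain x where x: "x \<in> carrier G - group_center G" "Coset.order G = 2 * card (centralizer G x)"
      by blast
    let ?A = "G\<lparr>carrier := centralizer G x\<rparr>"
    have A_sub: "subgroup (centralizer G x) G"
      using centralizer_subgroup x(1) by blast
    interpret A: fin_group ?A
      by (rule subgroup_fin_group[OF A_sub])
    obtain r where r: "2 \<le> r" "card (group_center ?A) = r * card (group_center G)"
      "?n = 2 * r * center_index ?A" "commuting_prob G \<le> commuting_prob ?A / 4 + 3 / (4 * real r)"
      using index_two_centralizer[OF x] .
    have A_nonab: "\<not> comm_group ?A"
    proof
      assume "comm_group ?A"
      then have "comm_group (G\<lparr>carrier := centralizer G w\<rparr>)"
        using centralizer_commute_if_abelian_index_two[OF A_sub x(2) _ w]
          comm_group_subgroup_iff A_sub centralizer_subgroup w by blast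
      then show False
        using nonab by contradiction
    qed
    consider "r = 2" | "r = 3" | "4 \<le> r"
      using r(1) by linarith
    then show False
    proof cases
      case 1
      then obtain H :: "'a set monoid" and i where H: "fin_group H"
        "commuting_prob G \<le> commuting_prob H / 2 + 1 / 8"
        "commuting_prob H / 2 < commuting_prob G" "?n = center_index H * 2 ^ i"
        using quotient_of_index_two_centralizer[OF x] r(2) by blast
      interpret H: fin_group H
        by (rule H(1))
      \<comment> \<open>An abelian \<open>H\<close> would give Pr(G) > 1/2.\<close>
      have "\<not> comm_group H"
        using H.abelian_commuting_prob H(3) no58 by force
      then have "commuting_prob H \<le> 5 / 8"
        by (rule H.commuting_prob_le_5_8)
      then have "commuting_prob G \<noteq> 1 / 2"
        using H(2) by simp
      have "3 / 7 \<le> commuting_prob H"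
        using H(2) no58 by auto
      then obtain k' where "center_index H dvd 3 * 2 ^ k'"
        using H.center_index_dvd by blast
      then have "?n dvd 3 * 2 ^ (k' + i)"
        unfolding H(4) power_add mult.assoc[symmetric] by (rule mult_dvd_mono) simp
      then show False
        using no_quotient \<open>commuting_prob G \<noteq> 1 / 2\<close> by blast
    next
      case 2
      have "commuting_prob G \<le> 13 / 32"
        using r(4) 2 A.commuting_prob_le_5_8[OF A_nonab] by simp
      \<comment> \<open>11/27 exceeds 13/32 narrowly.\<close>
      then have p': "commuting_prob G = 5 / 14 \<or> commuting_prob G = 2 / 5"
        using no58 by auto
      then have "3 / 7 \<le> commuting_prob ?A"
        using r(4) 2 by auto
      then obtain k' where "center_index ?A dvd 3 * 2 ^ k'"
        using A.center_index_dvd by blast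
      then have "6 * center_index ?A dvd 6 * (3 * 2 ^ k')"
        by (rule mult_dvd_mono[OF dvd_refl])
      then have "?n dvd 9 * 2 ^ Suc k'"
        using r(3) 2 by simp
      then show False
        using five_or_seven[OF p'] by blast
    next
      case 3
      then have "3 / (4 * real r) \<le> 3 / 16"
        by (simp add: field_simps)
      \<comment> \<open>11/32 is below 5/14, the smallest value allowed.\<close>
      then have "commuting_prob G \<le> 11 / 32"
        using r(4) A.commuting_prob_le_5_8[OF A_nonab] by simp
      then show False
        using no58 by auto
    qed
  qed
qed

end

theorem theorem4p1:
  fixes G :: "('a, 'b) monoid_scheme"
  assumes "group G"
    and "finite (carrier G)"
    and "commuting_prob G \<in> {5/14, 2/5, 11/27, 1/2, 5/8}"
  shows "super_integral G"
proof -
  interpret fin_group G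
    using assms(1,2) by (simp add: fin_group_def fin_group_axioms_def)
  show ?thesis
  proof (rule super_integral_if_commuting_transitive[OF assms(1,2)])
    show "\<not> comm_group G"
      using abelian_commuting_prob assms(3) by auto
    fix x y z
    assume x: "x \<in> carrier G - group_center G"
      and "y \<in> carrier G" "z \<in> carrier G" "x \<otimes>\<^bsub>G\<^esub> y = y \<otimes>\<^bsub>G\<^esub> x" "x \<otimes>\<^bsub>G\<^esub> z = z \<otimes>\<^bsub>G\<^esub> x"
    then have "y \<in> centralizer G x" "z \<in> centralizer G x"
      unfolding centralizer_def by blast+
    moreover have "comm_group (G\<lparr>carrier := centralizer G x\<rparr>)"
      using centralizer_abelian[OF assms(3) x] .
    moreover have "subgroup (centralizer G x) G"
      using x centralizer_subgroup by blast
    ultimately show "y \<otimes>\<^bsub>G\<^esub> z = z \<otimes>\<^bsub>G\<^esub> y"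
      using comm_group_subgroup_iff by blast
  qed
qed

end
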